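(* Let $q$ be a (conservative stable) $Q$-function on the nonempty Borel space $S$. Suppose there exist a monotone nondecreasing sequence $(S_n)\subseteq\mathcal B(S)$ and a nonnegative measurable function $V$ on $[0,\infty)\times S$ such that (a) $S_n\uparrow S$ as $n\uparrow\infty$; (b) for each $T>0$, $\inf_{v\in[0,T],\,x\in S\setminus S_n}V(v,x)\uparrow\infty$ as $n\uparrow\infty$; (c) for each $T>0$ and $n=1,2,\dots$, $\sup_{v\in[0,T],\,x\in S_n}q_x(v)<\infty$; (d) for each $T>0$ there is a constant $\alpha_T\in(0,\infty)$ such that $$\int_0^{T-v}\int_SV(t+v,y)\,e^{-\alpha_Tt-\int_0^tq_x(s+v)ds}\,\tilde q(dy|x,t+v)\,dt\le V(v,x)\quad\forall v\in[0,T],\ x\in S.$$ Then the nonhomogeneous Markov pure jump process $(X_t)$ with transition function $P_q$ is nonexplosive.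
   Context: $S$ is a nonempty Borel space with Borel $\sigma$-algebra $\mathcal B(S)$; measurability means Borel measurability; the infimum over the empty set is $+\infty$. A (conservative stable) $Q$-function on $S$ is a Borel-measurable signed kernel $q(dy|x,s)$ on $\mathcal B(S)$ from $S\times[0,\infty)$ such that (1) $0\le q(\Gamma|x,s)<\infty$ whenever $x\notin\Gamma\in\mathcal B(S)$, (2) $q(S|x,s)=0$ for all $(x,s)$, (3) $\sup_{s\ge0}q(S\setminus\{x\}|x,s)<\infty$ for each $x\in S$. Put $\tilde q(\Gamma|x,s):=q(\Gamma\setminus\{x\}|x,s)$ and $q_x(s):=-q(\{x\}|x,s)$. The $q$-transition function is $P_q:=\sum_{n\ge0}P_q^{(n)}$, where for $0\le s\le t<\infty$, $P_q^{(0)}(s,x,t,\Gamma)=\delta_x(\Gamma)e^{-\int_s^tq_x(v)dv}$ and $P_q^{(n+1)}(s,x,t,\Gamma)=\int_s^te^{-\int_s^uq_x(v)dv}\left(\int_SP_q^{(n)}(u,z,t,\Gamma)\tilde q(dz|x,u)\right)du$. The Markov pure jump process $(X_t)$ with transition function $P_q$ and initial state $x\in S$ (law $\mathbb P^q_x$): $x_0=x$, $t_0=0$, and, given the past up to the jump moment $t_n<\infty$ with post-jump state $x_n\in S$, the next pair $(t_{n+1},x_{n+1})$ has conditional law $e^{-\int_{t_n}^tq_{x_n}(v)dv}\tilde q(dy|x_n,t)\,dt$ on $(t_n,\infty)\times S$, the remaining mass being put on $t_{n+1}=\infty$, $x_{n+1}=x_\infty$, where $x_\infty\notin S$ is an isolated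 cemetery point; $X_t=x_n$ for $t_n\le t<t_{n+1}$ and $X_t=x_\infty$ for $t\ge t_\infty:=\lim_nt_n$. The process is nonexplosive if $\mathbb P_x^q(t_\infty=\infty)=1$ for all $x\in S$. *)

theory Defs
  imports "HOL-Probability.Probability"
begin

text \<open>
  A Borel space is a Borel subset \<open>S\<close> of a Polish space; functions and kernels on \<open>S\<close> are total
  functions whose values off \<open>S\<close> (and at negative times) are irrelevant.
\<close>

abbreviation borel_on :: "'a::topological_space set \<Rightarrow> 'a measure" where
  "borel_on S \<equiv> restrict_space borel S"

text \<open>
  Taking the disjoint sequence constantly empty gives \<open>\<mu> {} = 0\<close>. Real values suffice for
  \<open>Q\<close>-functions: \<open>q(S \<setminus> {x}) < \<infinity>\<close> and \<open>q(S) = 0\<close> force \<open>q({x})\<close> to be finite.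
\<close>

definition signed_measure_on :: "'a measure \<Rightarrow> ('a set \<Rightarrow> real) \<Rightarrow> bool" where
  "signed_measure_on M \<mu> \<longleftrightarrow>
    (\<forall>A::nat \<Rightarrow> 'a set. range A \<subseteq> sets M \<and> disjoint_family A \<longrightarrow> (\<lambda>i. \<mu> (A i)) sums \<mu> (\<Union>i. A i))"

text \<open>\<open>q \<Gamma> x s\<close> is \<open>q(\<Gamma>|x,s)\<close>.\<close>

definition q_function :: "'a::polish_space set \<Rightarrow> ('a set \<Rightarrow> 'a \<Rightarrow> real \<Rightarrow> real) \<Rightarrow> bool" where
  "q_function S q \<longleftrightarrow>
    (\<forall>x\<in>S. \<forall>s\<ge>0. signed_measure_on (borel_on S) (\<lambda>\<Gamma>. q \<Gamma> x s)) \<and>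
    (\<forall>\<Gamma>\<in>sets (borel_on S).
      (\<lambda>(x, s). q \<Gamma> x s) \<in> borel_measurable (borel_on S \<Otimes>\<^sub>M borel_on {0..})) \<and>
    (\<forall>x\<in>S. \<forall>s\<ge>0. \<forall>\<Gamma>\<in>sets (borel_on S). x \<notin> \<Gamma> \<longrightarrow> 0 \<le> q \<Gamma> x s) \<and>
    (\<forall>x\<in>S. \<forall>s\<ge>0. q S x s = 0) \<and>
    (\<forall>x\<in>S. bdd_above ((\<lambda>s. q (S - {x}) x s) ` {0..}))"

definition q_tilde ::
  "'a::polish_space set \<Rightarrow> ('a set \<Rightarrow> 'a \<Rightarrow> real \<Rightarrow> real) \<Rightarrow> 'a \<Rightarrow> real \<Rightarrow> 'a measure" where
  "q_tilde S q x s = measure_of S (sets (borel_on S)) (\<lambda>\<Gamma>. ennreal (q (\<Gamma> - {x}) x s))"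

definition q_rate :: "('a set \<Rightarrow> 'a \<Rightarrow> real \<Rightarrow> real) \<Rightarrow> 'a \<Rightarrow> real \<Rightarrow> real" where
  "q_rate q x s = - q {x} x s"

definition survival :: "('a set \<Rightarrow> 'a \<Rightarrow> real \<Rightarrow> real) \<Rightarrow> 'a \<Rightarrow> real \<Rightarrow> real \<Rightarrow> real" where
  "survival q x s t = exp (- (LBINT v:{s..t}. q_rate q x v))"

primrec q_transition_n ::
  "'a::polish_space set \<Rightarrow> ('a set \<Rightarrow> 'a \<Rightarrow> real \<Rightarrow> real) \<Rightarrow> nat \<Rightarrow>
    real \<Rightarrow> 'a \<Rightarrow> real \<Rightarrow> 'a set \<Rightarrow> ennreal" where
  "q_transition_n S q 0 s x t \<Gamma> = indicator \<Gamma> x * ennreal (survival q x s t)"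
| "q_transition_n S q (Suc n) s x t \<Gamma> =
    (\<integral>\<^sup>+u\<in>{s..t}. ennreal (survival q x s u) *
      (\<integral>\<^sup>+z. q_transition_n S q n u z t \<Gamma> \<partial>q_tilde S q x u) \<partial>lborel)"

definition q_transition ::
  "'a::polish_space set \<Rightarrow> ('a set \<Rightarrow> 'a \<Rightarrow> real \<Rightarrow> real) \<Rightarrow>
    real \<Rightarrow> 'a \<Rightarrow> real \<Rightarrow> 'a set \<Rightarrow> ennreal" where
  "q_transition S q s x t \<Gamma> = (\<Sum>n. q_transition_n S q n s x t \<Gamma>)"

text \<open>
  The cemetery \<open>x\<^sub>\<infinity>\<close> is \<open>None\<close>; being isolated, \<open>{None}\<close> is measurable. The process is
  described by the sequence \<open>\<omega> n = (t\<^sub>n, x\<^sub>n)\<close> of its jump moments in \<open>[0, \<infinity>]\<close> and post-jump states.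
\<close>

definition state_space :: "'a::topological_space set \<Rightarrow> 'a option measure" where
  "state_space S =
    sigma (insert None (Some ` S)) (insert {None} ((\<lambda>\<Gamma>. Some ` \<Gamma>) ` sets (borel_on S)))"

abbreviation jump_space :: "'a::topological_space set \<Rightarrow> (ennreal \<times> 'a option) measure" where
  "jump_space S \<equiv> borel \<Otimes>\<^sub>M state_space S"

text \<open>The part of the law of the next pair carried by \<open>(s, \<infinity>) \<times> S\<close>, after a jump to \<open>x\<close> at time \<open>s\<close>.\<close>

definition jump_intensity ::
  "'a::polish_space set \<Rightarrow> ('a set \<Rightarrow> 'a \<Rightarrow> real \<Rightarrow> real) \<Rightarrow>
    real \<Rightarrow> 'a \<Rightarrow> (ennreal \<times> 'a option) set \<Rightarrow> ennreal" where
  "jump_intensity S q s x B =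
    (\<integral>\<^sup>+u\<in>{s<..}. ennreal (survival q x s u) *
      emeasure (q_tilde S q x u) {y\<in>S. (ennreal u, Some y) \<in> B} \<partial>lborel)"

definition jump_kernel ::
  "'a::polish_space set \<Rightarrow> ('a set \<Rightarrow> 'a \<Rightarrow> real \<Rightarrow> real) \<Rightarrow>
    ennreal \<times> 'a option \<Rightarrow> (ennreal \<times> 'a option) measure" where
  "jump_kernel S q = (\<lambda>(s, y). case y of
      None \<Rightarrow> return (jump_space S) (\<infinity>, None)
    | Some x \<Rightarrow>
        if s = \<infinity> then return (jump_space S) (\<infinity>, None)
        else measure_of (space (jump_space S)) (sets (jump_space S))
          (\<lambda>B. jump_intensity S q (enn2real s) x B +
            (1 - jump_intensity S q (enn2real s) x (space (jump_space S))) * indicator B (\<infinity>, None)))"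

primrec jump_step ::
  "'a::polish_space set \<Rightarrow> ('a set \<Rightarrow> 'a \<Rightarrow> real \<Rightarrow> real) \<Rightarrow> 'a \<Rightarrow>
    nat \<Rightarrow> (nat \<Rightarrow> ennreal \<times> 'a option) \<Rightarrow> (ennreal \<times> 'a option) measure" where
  "jump_step S q x 0 \<omega> = return (jump_space S) (0, Some x)"
| "jump_step S q x (Suc n) \<omega> = jump_kernel S q (\<omega> n)"

text \<open>The law \<open>\<P>\<^sub>x\<^sup>q\<close> on sequences of pairs, by the Ionescu-Tulcea theorem.\<close>

definition jump_law ::
  "'a::polish_space set \<Rightarrow> ('a set \<Rightarrow> 'a \<Rightarrow> real \<Rightarrow> real) \<Rightarrow> 'a \<Rightarrow>
    (nat \<Rightarrow> ennreal \<times> 'a option) measure" where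
  "jump_law S q x =
    projective_family.lim UNIV (Ionescu_Tulcea.CI (jump_step S q x) (\<lambda>_. jump_space S))
      (\<lambda>_. jump_space S)"

definition explosion_time :: "(nat \<Rightarrow> ennreal \<times> 'a option) \<Rightarrow> ennreal" where
  "explosion_time \<omega> = lim (\<lambda>n. fst (\<omega> n))"

text \<open>Almost surely the \<open>t\<^sub>n\<close> are nondecreasing, so at most one \<open>n\<close> satisfies \<open>t\<^sub>n \<le> t < t\<^sub>n\<^sub>+\<^sub>1\<close>.\<close>

definition jump_process :: "real \<Rightarrow> (nat \<Rightarrow> ennreal \<times> 'a option) \<Rightarrow> 'a option" where
  "jump_process t \<omega> =
    (if \<exists>n. fst (\<omega> n) \<le> ennreal t \<and> ennreal t < fst (\<omega> (Suc n))
     then snd (\<omega> (LEAST n. fst (\<omega> n) \<le> ennreal t \<and> ennreal t < fst (\<omega> (Suc n))))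
     else None)"

definition nonexplosive ::
  "'a::polish_space set \<Rightarrow> ('a set \<Rightarrow> 'a \<Rightarrow> real \<Rightarrow> real) \<Rightarrow> bool" where
  "nonexplosive S q \<longleftrightarrow> (\<forall>x\<in>S. AE \<omega> in jump_law S q x. explosion_time \<omega> = \<infinity>)"

text \<open>
  The rest of the theory checks the construction: for a \<open>Q\<close>-function, \<open>jump_kernel\<close> is a Markov
  kernel, so that the Ionescu-Tulcea theorem applies and \<open>jump_law\<close> is a probability measure with
  the prescribed conditional laws; and \<open>P\<^sub>q\<close> describes the distributions of the process.
\<close>


lemma signed_measure_onD:
  "signed_measure_on M \<mu> \<Longrightarrow> range A \<subseteq> sets M \<Longrightarrow> disjoint_family A \<Longrightarrow>
    (\<lambda>i::nat. \<mu> (A i)) sums \<mu> (\<Union>i. A i)"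
  by (simp add: signed_measure_on_def)

lemma signed_measure_on_empty: assumes "signed_measure_on M \<mu>" shows "\<mu> {} = 0"
proof -
  have "(\<lambda>i::nat. \<mu> {}) sums \<mu> {}"
    using signed_measure_onD[OF assms, of "\<lambda>_. {}"] by (simp add: disjoint_family_on_def)
  then show ?thesis
    using sums_summable summable_const_iff by blast
qed

lemma signed_measure_on_Un:
  assumes "signed_measure_on M \<mu>" "A \<in> sets M" "B \<in> sets M" "A \<inter> B = {}"
  shows "\<mu> (A \<union> B) = \<mu> A + \<mu> B"
proof -
  have r: "range (binaryset A B) \<subseteq> sets M" using assms by (auto simp: binaryset_def)
  have d: "disjoint_family (binaryset A B)"
    using assms by (auto simp: disjoint_family_on_def binaryset_def)
  have "(\<lambda>i. \<mu> (binaryset A B i)) sums \<mu> (A \<union> B)"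
    using signed_measure_onD[OF assms(1) r d] by (simp add: UN_binaryset_eq)
  moreover have "(\<lambda>i. \<mu> (binaryset A B i)) sums (\<mu> A + \<mu> B)"
    by (rule binaryset_sums) (simp add: signed_measure_on_empty[OF assms(1)])
  ultimately show ?thesis by (rule sums_unique2)
qed

locale Q_function =
  fixes S :: "'a::polish_space set" and q
  assumes S[measurable]: "S \<in> sets borel" and q: "q_function S q"
begin

lemma sets_borel_on: "A \<in> sets (borel_on S) \<longleftrightarrow> A \<in> sets borel \<and> A \<subseteq> S"
  using S by (auto simp: sets_restrict_space_iff)

lemma q_signed: "x \<in> S \<Longrightarrow> 0 \<le> s \<Longrightarrow> signed_measure_on (borel_on S) (\<lambda>\<Gamma>. q \<Gamma> x s)"
  and q_meas: "\<Gamma> \<in> sets (borel_on S) \<Longrightarrow>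
      (\<lambda>(x, s). q \<Gamma> x s) \<in> borel_measurable (borel_on S \<Otimes>\<^sub>M borel_on {0..})"
  and q_nonneg: "x \<in> S \<Longrightarrow> 0 \<le> s \<Longrightarrow> \<Gamma> \<in> sets (borel_on S) \<Longrightarrow> x \<notin> \<Gamma> \<Longrightarrow> 0 \<le> q \<Gamma> x s"
  and q_conservative: "x \<in> S \<Longrightarrow> 0 \<le> s \<Longrightarrow> q S x s = 0"
  and q_stable: "x \<in> S \<Longrightarrow> bdd_above ((\<lambda>s. q (S - {x}) x s) ` {0..})"
  using q by (auto simp: q_function_def)

lemma q_rate_eq: assumes "x \<in> S" "0 \<le> s" shows "q_rate q x s = q (S - {x}) x s"
proof -
  have "q ({x} \<union> (S - {x})) x s = q {x} x s + q (S - {x}) x s"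
    using assms S by (intro signed_measure_on_Un[OF q_signed]) (auto simp: sets_borel_on)
  also have "{x} \<union> (S - {x}) = S" using assms by auto
  finally show ?thesis using assms by (simp add: q_rate_def q_conservative)
qed

lemma q_rate_nonneg: "x \<in> S \<Longrightarrow> 0 \<le> s \<Longrightarrow> 0 \<le> q_rate q x s"
  using S by (auto simp: q_rate_eq sets_borel_on intro!: q_nonneg)

lemma q_rate_bound: assumes "x \<in> S" obtains K where "\<And>s. 0 \<le> s \<Longrightarrow> q_rate q x s \<le> K"
  using q_stable[OF assms] by (auto simp: bdd_above_def q_rate_eq assms)

lemma space_q_tilde[simp]: "space (q_tilde S q x s) = S"
  and sets_q_tilde[simp, measurable_cong]: "sets (q_tilde S q x s) = sets (borel_on S)"
proof -
  have *: "sets (borel_on S) \<subseteq> Pow S" by (auto simp: sets_borel_on)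
  show "space (q_tilde S q x s) = S" unfolding q_tilde_def by (rule space_measure_of[OF *])
  have "sigma_sets (space (borel_on S)) (sets (borel_on S)) = sets (borel_on S)"
    by (rule sets.sigma_sets_eq)
  then show "sets (q_tilde S q x s) = sets (borel_on S)"
    unfolding q_tilde_def using * by (simp add: sets_measure_of space_restrict_space)
qed

lemma emeasure_q_tilde:
  assumes x: "x \<in> S" "0 \<le> s" and A: "A \<in> sets (borel_on S)"
  shows "emeasure (q_tilde S q x s) A = ennreal (q (A - {x}) x s)"
proof (rule emeasure_measure_of[OF q_tilde_def])
  show "sets (borel_on S) \<subseteq> Pow S" by (auto simp: sets_borel_on)
  show "A \<in> sets (q_tilde S q x s)" using A by simp
  show "positive (sets (q_tilde S q x s)) (\<lambda>\<Gamma>. ennreal (q (\<Gamma> - {x}) x s))"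
    using signed_measure_on_empty[OF q_signed[OF x]] by (simp add: positive_def)
  show "countably_additive (sets (q_tilde S q x s)) (\<lambda>\<Gamma>. ennreal (q (\<Gamma> - {x}) x s))"
  proof (rule countably_additiveI)
    fix B :: "nat \<Rightarrow> 'a set" assume B: "range B \<subseteq> sets (q_tilde S q x s)" "disjoint_family B"
    have r: "range (\<lambda>i. B i - {x}) \<subseteq> sets (borel_on S)" 
      using range_subsetD[OF B(1)] by (fastforce simp: sets_borel_on)
    have d: "disjoint_family (\<lambda>i. B i - {x})" using B(2) by (auto simp: disjoint_family_on_def)
    have "(\<lambda>i. q (B i - {x}) x s) sums q (\<Union>i. B i - {x}) x s"
      by (rule signed_measure_onD[OF q_signed[OF x] r d])
    then have "(\<Sum>i. ennreal (q (B i - {x}) x s)) = ennreal (q (\<Union>i. B i - {x}) x s)"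
      using r x by (intro suminf_ennreal_eq q_nonneg) auto
    then show "(\<Sum>i. ennreal (q (B i - {x}) x s)) = ennreal (q (\<Union> (range B) - {x}) x s)"
      by (simp add: Diff_eq)
  qed
qed

lemma emeasure_q_tilde_space: "x \<in> S \<Longrightarrow> 0 \<le> s \<Longrightarrow> emeasure (q_tilde S q x s) S = ennreal (q_rate q x s)"
  using S by (subst emeasure_q_tilde) (auto simp: sets_borel_on q_rate_eq)

lemma q_section_meas:
  assumes "C \<in> sets (borel_on S \<Otimes>\<^sub>M borel_on S)"
  shows "(\<lambda>(x, s). q {y\<in>S. (x, y) \<in> C} x s) \<in> borel_measurable (borel_on S \<Otimes>\<^sub>M borel_on {0..})"
proof -
  let ?M = "borel_on S \<Otimes>\<^sub>M borel_on {0::real..}"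
  let ?G = "{a \<times> b |a b. a \<in> sets (borel_on S) \<and> b \<in> sets (borel_on S)}"
  have sp: "space ?M = S \<times> {0..}" by (simp add: space_pair_measure space_restrict_space)
  have sec: "C \<in> sigma_sets (S \<times> S) ?G \<Longrightarrow> {y\<in>S. (x, y) \<in> C} \<in> sets (borel_on S)" for C x
  proof -
    assume "C \<in> sigma_sets (S \<times> S) ?G"
    then have "C \<in> sets (borel_on S \<Otimes>\<^sub>M borel_on S)"
      by (simp add: sets_pair_measure space_restrict_space)
    from sets_Pair1[OF this, of x] have "Pair x -` C \<in> sets (borel_on S)" .
    moreover have "Pair x -` C = {y\<in>S. (x, y) \<in> C}"
      using sets.sets_into_space[OF \<open>C \<in> sets _\<close>] by (auto simp: space_pair_measure space_restrict_space)
    ultimately show ?thesis by simp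
  qed
  have 1: "Int_stable ?G" by (rule Int_stable_pair_measure_generator)
  have 2: "?G \<subseteq> Pow (S \<times> S)" by (auto simp: sets_borel_on)
  have 3: "C \<in> sigma_sets (S \<times> S) ?G"
    using assms by (simp add: sets_pair_measure space_restrict_space)
  show ?thesis
  proof (induction rule: sigma_sets_induct_disjoint[OF 1 2 3, consumes 0, case_names basic empty compl union])
    case (basic A)
    then obtain a b where A: "A = a \<times> b" "a \<in> sets (borel_on S)" "b \<in> sets (borel_on S)" by auto
    have "(\<lambda>(x, s). indicator a x * q b x s) \<in> borel_measurable ?M"
    proof -
      have "(\<lambda>p. indicator a (fst p) * (\<lambda>(x, s). q b x s) p) \<in> borel_measurable ?M"
        using q_meas[OF A(3)] A(2) by measurable
      then show ?thesis by (simp add: split_beta)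
    qed
    also have "?this \<longleftrightarrow> ?case"
    proof (rule measurable_cong)
      fix p assume "p \<in> space ?M"
      then obtain x s where p: "p = (x, s)" "x \<in> S" "0 \<le> s" by (auto simp: sp)
      have "{y \<in> S. (x, y) \<in> A} = (if x \<in> a then b else {})"
        using A by (auto simp: sets_borel_on)
      then show "(case p of (x, s) \<Rightarrow> indicator a x * q b x s) = (case p of (x, s) \<Rightarrow> q {y \<in> S. (x, y) \<in> A} x s)"
        using signed_measure_on_empty[OF q_signed[OF p(2,3)]] by (simp add: p)
    qed
    finally show ?case .
  next
    case empty
    have "(\<lambda>_. 0::real) \<in> borel_measurable ?M" by simp
    also have "?this \<longleftrightarrow> ?case"
      by (rule measurable_cong) (auto simp: sp signed_measure_on_empty[OF q_signed])
    finally show ?case .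
  next
    case (compl A)
    have "(\<lambda>p. - (case p of (x, s) \<Rightarrow> q {y \<in> S. (x, y) \<in> A} x s)) \<in> borel_measurable ?M"
      using compl(2) by simp
    also have "?this \<longleftrightarrow> ?case"
    proof (rule measurable_cong)
      fix p assume "p \<in> space ?M"
      then obtain x s where p: "p = (x, s)" "x \<in> S" "0 \<le> s" by (auto simp: sp)
      have eq: "{y \<in> S. (x, y) \<in> S \<times> S - A} = S - {y \<in> S. (x, y) \<in> A}" using p by auto
      have "q ({y \<in> S. (x, y) \<in> A} \<union> (S - {y \<in> S. (x, y) \<in> A})) x s =
         q {y \<in> S. (x, y) \<in> A} x s + q (S - {y \<in> S. (x, y) \<in> A}) x s"
        using sec[OF compl(1), of x] S
        by (intro signed_measure_on_Un[OF q_signed[OF p(2,3)]]) (auto simp: sets_borel_on)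
      also have "{y \<in> S. (x, y) \<in> A} \<union> (S - {y \<in> S. (x, y) \<in> A}) = S" by auto
      finally show "- (case p of (x, s) \<Rightarrow> q {y \<in> S. (x, y) \<in> A} x s) =
         (case p of (x, s) \<Rightarrow> q {y \<in> S. (x, y) \<in> S \<times> S - A} x s)"
        unfolding p case_prod_conv eq using q_conservative[OF p(2,3)] by linarith
    qed
    finally show ?case .
  next
    case (union A)
    have "(\<lambda>p. \<Sum>i. (case p of (x, s) \<Rightarrow> q {y \<in> S. (x, y) \<in> A i} x s)) \<in> borel_measurable ?M"
      using union(3) by (rule borel_measurable_suminf)
    also have "?this \<longleftrightarrow> ?case"
    proof (rule measurable_cong)
      fix p assume "p \<in> space ?M"
      then obtain x s where p: "p = (x, s)" "x \<in> S" "0 \<le> s" by (auto simp: sp)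
      have "(\<lambda>i. q {y \<in> S. (x, y) \<in> A i} x s) sums q (\<Union>i. {y \<in> S. (x, y) \<in> A i}) x s"
        using union(1,2) sec
        by (intro signed_measure_onD[OF q_signed[OF p(2,3)]]) (auto simp: disjoint_family_on_def image_subset_iff)
      moreover have "(\<Union>i. {y \<in> S. (x, y) \<in> A i}) = {y \<in> S. (x, y) \<in> \<Union> (range A)}" by auto
      ultimately show "(\<Sum>i. (case p of (x, s) \<Rightarrow> q {y \<in> S. (x, y) \<in> A i} x s)) =
         (case p of (x, s) \<Rightarrow> q {y \<in> S. (x, y) \<in> \<Union> (range A)} x s)"
        by (simp add: p sums_iff)
    qed
    finally show ?case .
  qed
qed

lemma diagonal_sets: "{p \<in> S \<times> S. fst p = snd p} \<in> sets (borel_on S \<Otimes>\<^sub>M borel_on S)"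
proof -
  have f: "fst \<in> measurable (borel_on S \<Otimes>\<^sub>M borel_on S) (borel :: 'a measure)"
    "snd \<in> measurable (borel_on S \<Otimes>\<^sub>M borel_on S) (borel :: 'a measure)"
    by (rule measurable_compose[OF measurable_fst] measurable_compose[OF measurable_snd],
        rule measurable_restrict_space1, simp)+
  have "{p \<in> space (borel_on S \<Otimes>\<^sub>M borel_on S). fst p = snd p} \<in> sets (borel_on S \<Otimes>\<^sub>M borel_on S)"
    using f by measurable
  then show ?thesis by (simp add: space_pair_measure space_restrict_space)
qed

lemma q_tilde_meas:
  assumes C: "C \<in> sets (borel_on S)"
  shows "(\<lambda>(x, s). emeasure (q_tilde S q x s) C) \<in> borel_measurable (borel_on S \<Otimes>\<^sub>M borel_on {0..})"
proof -
  let ?M = "borel_on S \<Otimes>\<^sub>M borel_on {0::real..}"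
  let ?D = "S \<times> C - {p \<in> S \<times> S. fst p = snd p}"
  have sp: "space ?M = S \<times> {0..}" by (simp add: space_pair_measure space_restrict_space)
  have "?D \<in> sets (borel_on S \<Otimes>\<^sub>M borel_on S)"
    using diagonal_sets C S by (intro sets.Diff pair_measureI) (auto simp: sets_borel_on)
  from q_section_meas[OF this]
  have "(\<lambda>p. ennreal ((\<lambda>(x, s). q {y \<in> S. (x, y) \<in> ?D} x s) p)) \<in> borel_measurable ?M"
    by simp
  also have "?this \<longleftrightarrow> ?thesis"
  proof (rule measurable_cong)
    fix p assume "p \<in> space ?M"
    then obtain x s where p: "p = (x, s)" "x \<in> S" "0 \<le> s" by (auto simp: sp)
    have "{y \<in> S. (x, y) \<in> ?D} = C - {x}" using p C by (auto simp: sets_borel_on)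
    then show "ennreal ((\<lambda>(x, s). q {y \<in> S. (x, y) \<in> ?D} x s) p) = (\<lambda>(x, s). emeasure (q_tilde S q x s) C) p"
      using p C by (simp add: emeasure_q_tilde)
  qed
  finally show ?thesis .
qed

lemma q_rate_meas: "(\<lambda>(x, s). q_rate q x s) \<in> borel_measurable (borel_on S \<Otimes>\<^sub>M borel_on {0..})"
proof -
  have "(\<lambda>p. enn2real ((\<lambda>(x, s). emeasure (q_tilde S q x s) S) p)) \<in> borel_measurable (borel_on S \<Otimes>\<^sub>M borel_on {0..})"
    using q_tilde_meas[of S] S by (simp add: sets_borel_on)
  also have "?this \<longleftrightarrow> ?thesis"
    by (rule measurable_cong)
       (auto simp: space_pair_measure space_restrict_space emeasure_q_tilde_space q_rate_nonneg)
  finally show ?thesis .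
qed

definition nq :: "'a \<times> real \<Rightarrow> 'a measure" where
  "nq p = scale_measure (inverse (1 + ennreal (q_rate q (fst p) (snd p)))) (q_tilde S q (fst p) (snd p))"

lemma sets_nq[simp, measurable_cong]: "sets (nq p) = sets (borel_on S)" by (simp add: nq_def)

lemma inv1: "(1 + ennreal a) * inverse (1 + ennreal a) = 1"
  by (metis add_eq_0_iff_both_eq_0 divide_ennreal_def ennreal_add_eq_top ennreal_divide_self ennreal_neq_top ennreal_one_neq_top top.not_eq_extremum zero_neq_one)

lemma nq_meas: "nq \<in> measurable (borel_on S \<Otimes>\<^sub>M borel_on {0..}) (subprob_algebra (borel_on S))"
proof (rule measurable_subprob_algebra)
  let ?M = "borel_on S \<Otimes>\<^sub>M borel_on {0::real..}"
  fix p assume "p \<in> space ?M"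
  then obtain x s where p: "p = (x, s)" "x \<in> S" "0 \<le> s"
    by (auto simp: space_pair_measure space_restrict_space)
  have "inverse (1 + ennreal (q_rate q x s)) * ennreal (q_rate q x s) \<le>
    inverse (1 + ennreal (q_rate q x s)) * (1 + ennreal (q_rate q x s))"
    by (intro mult_left_mono) auto
  also have "\<dots> = 1" using inv1 by (simp add: mult.commute)
  finally show "subprob_space (nq p)"
    using p by (intro subprob_spaceI) (auto simp: nq_def emeasure_q_tilde_space space_scale_measure)
next
  let ?M = "borel_on S \<Otimes>\<^sub>M borel_on {0::real..}"
  fix A assume A: "A \<in> sets (borel_on S)"
  have [measurable]: "(\<lambda>p. emeasure (q_tilde S q (fst p) (snd p)) A) \<in> borel_measurable ?M"
    using q_tilde_meas[OF A] by (simp add: split_beta')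
  have [measurable]: "(\<lambda>p. q_rate q (fst p) (snd p)) \<in> borel_measurable ?M"
    using q_rate_meas by (simp add: split_beta')
  show "(\<lambda>p. emeasure (nq p) A) \<in> borel_measurable ?M"
    unfolding nq_def by simp
qed simp

lemma nn_integral_nq:
  "f \<in> borel_measurable (borel_on S) \<Longrightarrow> (1 + ennreal (q_rate q x s)) * (\<integral>\<^sup>+y. f y \<partial>nq (x, s)) = (\<integral>\<^sup>+y. f y \<partial>q_tilde S q x s)"
  unfolding nq_def
  by (simp add: nn_integral_scale_measure mult.assoc[symmetric] inv1 measurable_cong_sets[OF sets_q_tilde refl])

lemma nn_integral_q_tilde_measurable:
  assumes f: "(\<lambda>(l, y). f l y) \<in> borel_measurable (L \<Otimes>\<^sub>M borel_on S)"
    and a: "a \<in> measurable L (borel_on S)" and b: "b \<in> measurable L (borel_on {0..})"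
  shows "(\<lambda>l. \<integral>\<^sup>+y. f l y \<partial>q_tilde S q (a l) (b l)) \<in> borel_measurable L"
proof -
  have ab: "(\<lambda>l. (a l, b l)) \<in> measurable L (borel_on S \<Otimes>\<^sub>M borel_on {0..})"
    using a b by simp
  have "(\<lambda>l. nq (a l, b l)) \<in> measurable L (subprob_algebra (borel_on S))"
    using measurable_compose[OF ab nq_meas] .
  from nn_integral_measurable_subprob_algebra2[OF f this]
  have [measurable]: "(\<lambda>l. \<integral>\<^sup>+y. f l y \<partial>nq (a l, b l)) \<in> borel_measurable L" .
  have [measurable]: "(\<lambda>l. q_rate q (a l) (b l)) \<in> borel_measurable L"
    using measurable_compose[OF ab q_rate_meas] by simp
  have "(\<lambda>l. (1 + ennreal (q_rate q (a l) (b l))) * (\<integral>\<^sup>+y. f l y \<partial>nq (a l, b l))) \<in> borel_measurable L"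
    by measurable
  also have "?this \<longleftrightarrow> ?thesis"
  proof (rule measurable_cong)
    fix l assume "l \<in> space L"
    then have "f l \<in> borel_measurable (borel_on S)"
      using measurable_compose[OF measurable_Pair1' f, of l] by simp
    then show "(1 + ennreal (q_rate q (a l) (b l))) * (\<integral>\<^sup>+y. f l y \<partial>nq (a l, b l)) =
      (\<integral>\<^sup>+y. f l y \<partial>q_tilde S q (a l) (b l))" by (rule nn_integral_nq)
  qed
  finally show ?thesis .
qed

end


context Q_function
begin

abbreviation R :: "'a \<Rightarrow> real \<Rightarrow> real" where "R x v \<equiv> q_rate q x (max 0 v)"

lemma R_nonneg: "x \<in> S \<Longrightarrow> 0 \<le> R x v" by (simp add: q_rate_nonneg)

lemma R_measurable:
  assumes "a \<in> measurable L (borel_on S)" "b \<in> borel_measurable L"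
  shows "(\<lambda>l. R (a l) (b l)) \<in> borel_measurable L"
proof -
  have "(\<lambda>l. max 0 (b l)) \<in> measurable L (borel_on {0..})"
    using assms(2) by (intro measurable_restrict_space2) auto
  with assms(1) have "(\<lambda>l. (a l, max 0 (b l))) \<in> measurable L (borel_on S \<Otimes>\<^sub>M borel_on {0..})" by simp
  from measurable_compose[OF this q_rate_meas] show ?thesis by simp
qed

lemma R_measurable1: "x \<in> S \<Longrightarrow> R x \<in> borel_measurable borel"
  by (rule R_measurable) (auto simp: space_restrict_space)

lemma survival_R: "0 \<le> s \<Longrightarrow> survival q x s t = exp (- (LBINT v:{s..t}. R x v))"
  unfolding survival_def by (intro arg_cong[where f=exp] arg_cong[where f=uminus] set_lebesgue_integral_cong) auto

lemma R_set_integrable: assumes "x \<in> S" shows "set_integrable lborel {s..t} (R x)"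
proof -
  obtain K where K: "\<And>s. 0 \<le> s \<Longrightarrow> q_rate q x s \<le> K" using q_rate_bound[OF assms] by blast
  show ?thesis unfolding set_integrable_def
  proof (rule integrableI_bounded_set_indicator[where B=K])
    show "R x \<in> borel_measurable lborel" using R_measurable1[OF assms] by simp
    show "AE v in lborel. v \<in> {s..t} \<longrightarrow> norm (R x v) \<le> K"
      using K R_nonneg[OF assms] by auto
  qed (auto simp: emeasure_lborel_Icc_eq)
qed

lemma survival_le_1: "x \<in> S \<Longrightarrow> 0 \<le> s \<Longrightarrow> survival q x s t \<le> 1"
  by (auto simp: survival_R set_lebesgue_integral_def intro!: integral_nonneg_AE AE_I2 mult_nonneg_nonneg R_nonneg)

lemma survival_measurable:
  assumes "a \<in> measurable L (borel_on S)" "b \<in> borel_measurable L" "c \<in> borel_measurable L"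
    and "\<And>l. l \<in> space L \<Longrightarrow> 0 \<le> b l"
  shows "(\<lambda>l. survival q (a l) (b l) (c l)) \<in> borel_measurable L"
proof -
  note [measurable] = assms(1-3)
  have [measurable]: "(\<lambda>(l, v). R (a l) v) \<in> borel_measurable (L \<Otimes>\<^sub>M lborel)"
    unfolding split_beta' by (rule R_measurable) measurable
  have "(\<lambda>l. exp (- (LINT v|lborel. (if b l \<le> v \<and> v \<le> c l then R (a l) v else 0)))) \<in> borel_measurable L"
    by measurable
  also have "?this \<longleftrightarrow> ?thesis"
    by (rule measurable_cong)
       (auto simp: survival_R assms(4) set_lebesgue_integral_def intro!: Bochner_Integration.integral_cong)
  finally show ?thesis .
qed

lemma survival_integral:
  assumes x: "x \<in> S" and s: "0 \<le> s" and st: "s \<le> t"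
  shows "(\<integral>\<^sup>+u\<in>{s..t}. ennreal (survival q x s u) * ennreal (q_rate q x u) \<partial>lborel)
    = ennreal (1 - survival q x s t)"
proof -
  obtain K where K: "\<And>s. 0 \<le> s \<Longrightarrow> q_rate q x s \<le> K" using q_rate_bound[OF x] by blast
  then have K': "R x v \<le> K" for v by simp
  have K0: "0 \<le> K" using K' R_nonneg[OF x] order_trans by blast
  define Q where "Q u = (LBINT v:{s..u}. R x v)" for u
  define I where "I u = (LBINT v:{s..u}. R x v * exp (- Q v))" for u
  have surv: "survival q x s u = exp (- Q u)" for u using s by (simp add: survival_R Q_def)
  have surv_meas[measurable]: "(\<lambda>u. exp (- Q u)) \<in> borel_measurable borel"
    unfolding surv[symmetric]
    by (rule survival_measurable) (auto simp: space_restrict_space x s)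
  have [measurable]: "R x \<in> borel_measurable borel" by (rule R_measurable1[OF x])
  have nn: "0 \<le> (LBINT v:{a..b}. R x v)" for a b
    by (auto simp: set_lebesgue_integral_def intro!: integral_nonneg_AE AE_I2 mult_nonneg_nonneg R_nonneg x)
  have le: "(LBINT v:{a..b}. R x v) \<le> K * (b - a)" if "a \<le> b" for a b
  proof -
    have "(LBINT v:{a..b}. R x v) \<le> (LBINT v:{a..b}. K)"
    proof (rule set_integral_mono)
      show "set_integrable lborel {a..b} (\<lambda>_. K)"
        unfolding set_integrable_def by (intro integrable_scaleR_left) (simp add: emeasure_lborel_Icc_eq)
    qed (auto simp: R_set_integrable x K')
    also have "\<dots> = K * (b - a)" using that by (simp add: set_lebesgue_integral_def)
    finally show ?thesis .
  qed
  have int: "set_integrable lborel {a..b} (\<lambda>v. R x v * exp (- Q v))" for a b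
    unfolding set_integrable_def
  proof (rule integrableI_bounded_set_indicator[where B=K])
    have "R x v * exp (- Q v) \<le> K * 1" for v
      using K' R_nonneg[OF x] K0 nn by (intro mult_mono) (auto simp: Q_def)
    then show "AE v in lborel. v \<in> {a..b} \<longrightarrow> norm (R x v * exp (- Q v)) \<le> K"
      using R_nonneg[OF x] by (auto simp: abs_mult)
  qed (auto simp: emeasure_lborel_Icc_eq)
  have split: "(LBINT v:{s..b}. f v) = (LBINT v:{s..a}. f v) + (LBINT v:{a..b}. f v)"
    if "s \<le> a" "a \<le> b" "\<And>a b. set_integrable lborel {a..b} f" for a b and f :: "real \<Rightarrow> real"
  proof -
    have eq: "{s..b} = {s..a} \<union> {a..b}" using that by auto
    show ?thesis unfolding eq
      by (rule set_integral_Un_AE) (use that AE_lborel_singleton[of a] in auto)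
  qed
  have Qd: "Q b = Q a + (LBINT v:{a..b}. R x v)" if "s \<le> a" "a \<le> b" for a b
    unfolding Q_def by (rule split) (use that R_set_integrable x in auto)
  have Qm: "Q a \<le> Q b" if "s \<le> a" "a \<le> b" for a b
    unfolding Qd[OF that] using nn[of a b] by simp
  define D where "D u = I u - (1 - exp (- Q u))" for u
  have bound: "\<bar>D b - D a\<bar> \<le> K\<^sup>2 * (b - a)\<^sup>2" if ab: "s \<le> a" "a \<le> b" for a b
  proof -
    define \<delta> where "\<delta> = (LBINT v:{a..b}. R x v)"
    have d: "0 \<le> \<delta>" "\<delta> \<le> K * (b - a)" "Q b = Q a + \<delta>" and Qa: "0 \<le> Q a"
      unfolding \<delta>_def using nn le[OF ab(2)] Qd[OF ab] by (auto simp: Q_def)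
    define J where "J = (LBINT v:{a..b}. R x v * exp (- Q v))"
    have J: "I b = I a + J" unfolding I_def J_def by (rule split) (use ab int in auto)
    have "J \<le> (LBINT v:{a..b}. R x v * exp (- Q a))"
      unfolding J_def using ab
      by (intro set_integral_mono int set_integrable_mult_left R_set_integrable x mult_left_mono R_nonneg)
         (auto intro: Qm)
    then have J1: "J \<le> \<delta> * exp (- Q a)" by (simp add: \<delta>_def)
    have "(LBINT v:{a..b}. R x v * exp (- Q b)) \<le> J"
      unfolding J_def using ab
      by (intro set_integral_mono int set_integrable_mult_left R_set_integrable x mult_left_mono R_nonneg)
         (auto intro: Qm)
    then have J2: "\<delta> * exp (- Q b) \<le> J" by (simp add: \<delta>_def)
    have e1: "1 - exp (- \<delta>) \<le> \<delta>" using exp_ge_add_one_self[of "-\<delta>"] by simp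
    have e2: "\<delta> * exp (- \<delta>) \<le> 1 - exp (- \<delta>)"
    proof -
      have "(1 + \<delta>) * exp (- \<delta>) \<le> exp \<delta> * exp (- \<delta>)"
        by (intro mult_right_mono exp_ge_add_one_self) auto
      then show ?thesis by (simp add: algebra_simps exp_minus_inverse)
    qed
    have Qb: "exp (- Q b) = exp (- Q a) * exp (- \<delta>)" by (simp add: d exp_diff exp_minus field_simps)
    define E where "E = exp (- Q a)"
    have E: "0 \<le> E" "E \<le> 1" using Qa by (auto simp: E_def)
    have dd: "D b - D a = J - E * (1 - exp (- \<delta>))"
      by (simp add: D_def J Qb E_def algebra_simps)
    have "J - E * (1 - exp (- \<delta>)) \<le> \<delta> * E - E * (\<delta> * exp (- \<delta>))"
      using J1[folded E_def] mult_left_mono[OF e2 E(1)] by linarith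
    also have "\<dots> = E * \<delta> * (1 - exp (- \<delta>))" by (simp add: algebra_simps)
    also have "\<dots> \<le> 1 * \<delta> * \<delta>" using E d e1 by (intro mult_mono) auto
    finally have u: "D b - D a \<le> \<delta> * \<delta>" by (simp add: dd)
    have "E * (1 - exp (- \<delta>)) - J \<le> E * \<delta> - \<delta> * (E * exp (- \<delta>))"
      using J2[unfolded Qb, folded E_def] mult_left_mono[OF e1 E(1)] by linarith
    also have "\<dots> = E * \<delta> * (1 - exp (- \<delta>))" by (simp add: algebra_simps)
    also have "\<dots> \<le> 1 * \<delta> * \<delta>" using E d e1 by (intro mult_mono) auto
    finally have l: "- (D b - D a) \<le> \<delta> * \<delta>" by (simp add: dd)
    have "\<bar>D b - D a\<bar> \<le> \<delta> * \<delta>" using u l by linarith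
    also have "\<dots> \<le> (K * (b - a)) * (K * (b - a))" using d K0 ab by (intro mult_mono) auto
    finally show ?thesis by (simp add: power2_eq_square algebra_simps)
  qed
  have bound': "\<bar>D b - D a\<bar> \<le> K\<^sup>2 * (b - a)\<^sup>2" if "s \<le> a" "s \<le> b" for a b
    using bound[of a b] bound[of b a] that by (cases "a \<le> b") (auto simp: abs_minus_commute power2_commute)
  have "(D has_field_derivative 0) (at a within {s..t})" if "a \<in> {s..t}" for a
    unfolding has_field_derivative_iff
  proof (rule Lim_null_comparison)
    show "((\<lambda>b. K\<^sup>2 * \<bar>b - a\<bar>) \<longlongrightarrow> 0) (at a within {s..t})"
      by (auto intro!: tendsto_eq_intros)
    have "norm ((D b - D a) / (b - a)) \<le> K\<^sup>2 * \<bar>b - a\<bar>" if b: "b \<in> {s..t}" "b \<noteq> a" for b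
    proof -
      have "\<bar>D b - D a\<bar> \<le> (K\<^sup>2 * \<bar>b - a\<bar>) * \<bar>b - a\<bar>"
        using bound'[of a b] \<open>a \<in> _\<close> b by (simp add: power2_eq_square mult.assoc)
      then show ?thesis using b by (simp add: divide_le_eq)
    qed
    then show "\<forall>\<^sub>F b in at a within {s..t}. norm ((D b - D a) / (b - a)) \<le> K\<^sup>2 * \<bar>b - a\<bar>"
      by (auto simp: eventually_at_filter)
  qed
  then obtain c where c: "\<And>u. u \<in> {s..t} \<Longrightarrow> D u = c"
    using has_field_derivative_zero_constant[of "{s..t}" D] by auto
  have single: "(LBINT v:{s..s}. f v) = 0" for f :: "real \<Rightarrow> real"
    unfolding set_lebesgue_integral_def
    by (rule integral_eq_zero_AE) (use AE_lborel_singleton[of s] in \<open>auto elim!: eventually_mono\<close>)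
  have "D s = 0" by (simp only: D_def I_def Q_def single) simp
  then have "D t = 0" using c[of s] c[of t] st by simp
  then have It: "I t = 1 - survival q x s t" by (simp add: D_def surv)
  have "(\<integral>\<^sup>+u\<in>{s..t}. ennreal (survival q x s u) * ennreal (q_rate q x u) \<partial>lborel) =
      (\<integral>\<^sup>+u. ennreal (indicator {s..t} u * (R x u * exp (- Q u))) \<partial>lborel)"
    by (intro nn_integral_cong)
       (use s in \<open>auto simp: surv mult.commute ennreal_mult' split: split_indicator\<close>)
  also have "\<dots> = ennreal (LINT u|lborel. indicator {s..t} u * (R x u * exp (- Q u)))"
    using int[of s t] R_nonneg[OF x]
    by (intro nn_integral_eq_integral) (auto simp: set_integrable_def)
  also have "\<dots> = ennreal (I t)" by (simp add: I_def set_lebesgue_integral_def)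
  finally show ?thesis by (simp add: It)
qed

end


lemma space_state_space: "space (state_space S) = insert None (Some ` S)"
  and sets_state_space: "sets (state_space S) =
    sigma_sets (insert None (Some ` S)) (insert {None} ((\<lambda>\<Gamma>. Some ` \<Gamma>) ` sets (borel_on S)))"
proof -
  have "insert {None} ((\<lambda>\<Gamma>. Some ` \<Gamma>) ` sets (borel_on S)) \<subseteq> Pow (insert None (Some ` S))"
    using sets.sets_into_space[of _ "borel_on S"] by (auto simp: space_restrict_space)
  then show "space (state_space S) = insert None (Some ` S)" "sets (state_space S) =
    sigma_sets (insert None (Some ` S)) (insert {None} ((\<lambda>\<Gamma>. Some ` \<Gamma>) ` sets (borel_on S)))"
    unfolding state_space_def by simp_all
qed

lemma None_sets_state_space[measurable]: "{None} \<in> sets (state_space S)"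
  by (simp add: sets_state_space)

lemma Some_image_sets: "A \<in> sets (borel_on S) \<Longrightarrow> Some ` A \<in> sets (state_space S)"
  by (auto simp: sets_state_space)

lemma measurable_Some_state_space[measurable]: "Some \<in> measurable (borel_on S) (state_space S)"
  unfolding state_space_def
proof (rule measurable_measure_of)
  show "insert {None} ((\<lambda>\<Gamma>. Some ` \<Gamma>) ` sets (borel_on S)) \<subseteq> Pow (insert None (Some ` S))"
    using sets.sets_into_space[of _ "borel_on S"] by (auto simp: space_restrict_space)
  fix A assume "A \<in> insert {None} ((\<lambda>\<Gamma>. Some ` \<Gamma>) ` sets (borel_on S))"
  then consider "A = {None}" | \<Gamma> where "A = Some ` \<Gamma>" "\<Gamma> \<in> sets (borel_on S)" by blast
  then show "Some -` A \<inter> space (borel_on S) \<in> sets (borel_on S)"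
  proof cases
    case (2 \<Gamma>)
    have "Some -` A \<inter> space (borel_on S) = \<Gamma>"
      using sets.sets_into_space[OF 2(2)] unfolding 2(1) by blast
    then show ?thesis using 2 by simp
  next
    case 1
    then have "Some -` A \<inter> space (borel_on S) = {}" by auto
    then show ?thesis by simp
  qed
next
  show "Some \<in> space (borel_on S) \<rightarrow> insert None (Some ` S)"
    by (simp add: space_restrict_space)
qed

lemma measurable_case_state_space:
  assumes "x0 \<in> S"
  shows "case_option x0 (\<lambda>x. x) \<in> measurable (state_space S) (borel_on S)"
proof (rule measurableI)
  fix A assume A: "A \<in> sets (borel_on S)"
  have "case_option x0 (\<lambda>x. x) -` A \<inter> space (state_space S) = (if x0 \<in> A then {None} else {}) \<union> Some ` A"
    using sets.sets_into_space[OF A] by (auto simp: space_state_space space_restrict_space split: option.splits)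
  then show "case_option x0 (\<lambda>x. x) -` A \<inter> space (state_space S) \<in> sets (state_space S)"
    using Some_image_sets[OF A] by (auto simp del: Un_insert_left)
qed (use assms in \<open>auto simp: space_state_space space_restrict_space\<close>)

context Q_function
begin

definition JI :: "real \<Rightarrow> 'a \<Rightarrow> (ennreal \<times> 'a option \<Rightarrow> ennreal) \<Rightarrow> ennreal" where
  "JI s x f = (\<integral>\<^sup>+u\<in>{s<..}. ennreal (survival q x s u) *
      (\<integral>\<^sup>+y. f (ennreal u, Some y) \<partial>q_tilde S q x u) \<partial>lborel)"

lemma JI_R:
  "0 \<le> s \<Longrightarrow> JI s x f = (\<integral>\<^sup>+u. (if s < u then ennreal (survival q x s u) *
      (\<integral>\<^sup>+y. f (ennreal u, Some y) \<partial>q_tilde S q x (max 0 u)) else 0) \<partial>lborel)"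
  unfolding JI_def by (intro nn_integral_cong) (auto simp: max_def)

lemma JI_body_measurable:
  assumes [measurable]: "f \<in> borel_measurable (jump_space S)"
    and [measurable]: "a \<in> measurable L (borel_on S)" "b \<in> borel_measurable L" "c \<in> borel_measurable L"
    and nn: "\<And>l. l \<in> space L \<Longrightarrow> 0 \<le> b l"
  shows "(\<lambda>l. if b l < c l then ennreal (survival q (a l) (b l) (c l)) *
      (\<integral>\<^sup>+y. f (ennreal (c l), Some y) \<partial>q_tilde S q (a l) (max 0 (c l))) else 0) \<in> borel_measurable L"
proof -
  have [measurable]: "(\<lambda>l. survival q (a l) (b l) (c l)) \<in> borel_measurable L"
    by (rule survival_measurable) (auto simp: nn)
  have "(\<lambda>l. \<integral>\<^sup>+y. f (ennreal (c l), Some y) \<partial>q_tilde S q (a l) (max 0 (c l))) \<in> borel_measurable L"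
  proof (rule nn_integral_q_tilde_measurable)
    show "(\<lambda>l. max 0 (c l)) \<in> measurable L (borel_on {0..})"
      by (intro measurable_restrict_space2) auto
  qed measurable
  then show ?thesis by measurable
qed

lemma JI_measurable:
  assumes [measurable]: "f \<in> borel_measurable (jump_space S)"
    and [measurable]: "a \<in> measurable L (borel_on S)" "b \<in> borel_measurable L"
    and nn: "\<And>l. l \<in> space L \<Longrightarrow> 0 \<le> b l"
  shows "(\<lambda>l. JI (b l) (a l) f) \<in> borel_measurable L"
proof -
  have "(\<lambda>p. if b (fst p) < snd p then ennreal (survival q (a (fst p)) (b (fst p)) (snd p)) *
      (\<integral>\<^sup>+y. f (ennreal (snd p), Some y) \<partial>q_tilde S q (a (fst p)) (max 0 (snd p))) else 0)
      \<in> borel_measurable (L \<Otimes>\<^sub>M lborel)"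
    by (rule JI_body_measurable) (auto simp: space_pair_measure nn)
  then have "(\<lambda>l. \<integral>\<^sup>+u. (if b l < u then ennreal (survival q (a l) (b l) u) *
      (\<integral>\<^sup>+y. f (ennreal u, Some y) \<partial>q_tilde S q (a l) (max 0 u)) else 0) \<partial>lborel) \<in> borel_measurable L"
    by (intro lborel.borel_measurable_nn_integral) (simp add: split_beta')
  also have "?this \<longleftrightarrow> ?thesis"
    by (rule measurable_cong) (simp add: JI_R nn)
  finally show ?thesis .
qed

lemma JI_body_measurable1:
  assumes "f \<in> borel_measurable (jump_space S)" "x \<in> S" "0 \<le> s"
  shows "(\<lambda>u. if s < u then ennreal (survival q x s u) *
      (\<integral>\<^sup>+y. f (ennreal u, Some y) \<partial>q_tilde S q x (max 0 u)) else 0) \<in> borel_measurable borel"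
  by (rule JI_body_measurable) (use assms in \<open>auto simp: space_restrict_space\<close>)

lemma section_measurable:
  "f \<in> borel_measurable (jump_space S) \<Longrightarrow> (\<lambda>y. f (u, Some y)) \<in> borel_measurable (q_tilde S q x v)"
  unfolding measurable_cong_sets[OF sets_q_tilde refl]
  by (rule measurable_compose[where N="jump_space S" and f="\<lambda>y. (u, Some y)"]) measurable

lemma jump_intensity_JI:
  assumes B: "B \<in> sets (jump_space S)"
  shows "jump_intensity S q s x B = JI s x (indicator B)"
proof -
  have "emeasure (q_tilde S q x u) {y \<in> S. (ennreal u, Some y) \<in> B} =
     (\<integral>\<^sup>+y. indicator B (ennreal u, Some y) \<partial>q_tilde S q x u)" for u
  proof -
    have "(\<lambda>y. (ennreal u, Some y)) \<in> measurable (q_tilde S q x u) (jump_space S)" by measurable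
    from measurable_sets[OF this B]
    have m: "{y \<in> S. (ennreal u, Some y) \<in> B} \<in> sets (q_tilde S q x u)"
      by (simp add: vimage_def Int_def conj_commute)
    have "(\<integral>\<^sup>+y. indicator B (ennreal u, Some y) \<partial>q_tilde S q x u) =
      (\<integral>\<^sup>+y. indicator {y \<in> S. (ennreal u, Some y) \<in> B} y \<partial>q_tilde S q x u)"
      by (intro nn_integral_cong) (auto split: split_indicator)
    then show ?thesis using m by simp
  qed
  then show ?thesis by (simp add: jump_intensity_def JI_def)
qed

lemma JI_suminf:
  assumes f: "\<And>i::nat. f i \<in> borel_measurable (jump_space S)" and x: "x \<in> S" "0 \<le> s"
  shows "JI s x (\<lambda>p. \<Sum>i. f i p) = (\<Sum>i. JI s x (f i))"
proof -
  have "(\<Sum>i. JI s x (f i)) = (\<integral>\<^sup>+u. (\<Sum>i. (if s < u then ennreal (survival q x s u) *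
      (\<integral>\<^sup>+y. f i (ennreal u, Some y) \<partial>q_tilde S q x (max 0 u)) else 0)) \<partial>lborel)"
    unfolding JI_R[OF x(2)]
    by (rule nn_integral_suminf[symmetric]) (use JI_body_measurable1[OF f x] in simp)
  also have "\<dots> = JI s x (\<lambda>p. \<Sum>i. f i p)"
    unfolding JI_R[OF x(2)]
    by (intro nn_integral_cong) (auto simp: nn_integral_suminf[OF section_measurable[OF f]])
  finally show ?thesis ..
qed

lemma JI_zero: "JI s x (\<lambda>_. 0) = 0" by (simp add: JI_def)

lemma JI_mono: "(\<And>p. p \<in> space (jump_space S) \<Longrightarrow> f p \<le> g p) \<Longrightarrow> JI s x f \<le> JI s x g"
  unfolding JI_def
  by (intro nn_integral_mono mult_right_mono mult_left_mono) (auto simp: space_pair_measure space_state_space)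

lemma JI_cong: "(\<And>p. p \<in> space (jump_space S) \<Longrightarrow> f p = g p) \<Longrightarrow> JI s x f = JI s x g"
  by (intro antisym JI_mono) auto

lemma JI_upto:
  assumes x: "x \<in> S" and s: "0 \<le> s" and st: "s \<le> t"
  shows "JI s x (indicator ({..ennreal t} \<times> space (state_space S))) = ennreal (1 - survival q x s t)"
proof -
  have "JI s x (indicator ({..ennreal t} \<times> space (state_space S))) =
     (\<integral>\<^sup>+u\<in>{s..t}. ennreal (survival q x s u) * ennreal (q_rate q x u) \<partial>lborel)"
    unfolding JI_def
  proof (rule nn_integral_cong_AE, use AE_lborel_singleton[of s] in eventually_elim)
    fix u assume "u \<noteq> s"
    have "(\<integral>\<^sup>+y. indicator ({..ennreal t} \<times> space (state_space S)) (ennreal u, Some y) \<partial>q_tilde S q x u) =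
       (\<integral>\<^sup>+y. (if u \<le> t then 1 else 0) \<partial>q_tilde S q x u)" if "s < u"
      by (rule nn_integral_cong) (use that s st in \<open>auto simp: space_state_space split: split_indicator\<close>)
    then show "ennreal (survival q x s u) *
         (\<integral>\<^sup>+y. indicator ({..ennreal t} \<times> space (state_space S)) (ennreal u, Some y) \<partial>q_tilde S q x u) *
         indicator {s<..} u =
         ennreal (survival q x s u) * ennreal (q_rate q x u) * indicator {s..t} u"
      using s \<open>u \<noteq> s\<close> by (auto simp: emeasure_q_tilde_space x split: split_indicator)
  qed
  then show ?thesis using survival_integral[OF x s st] by simp
qed

lemma JI_space_le_1:
  assumes x: "x \<in> S" and s: "0 \<le> s"
  shows "JI s x (indicator (space (jump_space S))) \<le> 1"
proof -
  let ?g = "\<lambda>t u. if s < u \<and> u \<le> t then ennreal (survival q x s u) * ennreal (q_rate q x u) else 0"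
  have "JI s x (indicator (space (jump_space S))) =
     (\<integral>\<^sup>+u. (SUP n::nat. ?g (s + real n) u) \<partial>lborel)"
    unfolding JI_def
  proof (rule nn_integral_cong)
    fix u
    have e: "(\<integral>\<^sup>+y. indicator (space (jump_space S)) (ennreal u, Some y) \<partial>q_tilde S q x u) =
       (\<integral>\<^sup>+y. 1 \<partial>q_tilde S q x u)"
      by (rule nn_integral_cong) (auto simp: space_pair_measure space_state_space)
    show "ennreal (survival q x s u) *
         (\<integral>\<^sup>+y. indicator (space (jump_space S)) (ennreal u, Some y) \<partial>q_tilde S q x u) *
         indicator {s<..} u = (SUP n::nat. ?g (s + real n) u)"
    proof (cases "s < u")
      case True
      obtain n where n: "u \<le> s + real n" using real_arch_simple[of "u - s"] by (auto simp: algebra_simps)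
      have "(SUP n::nat. ?g (s + real n) u) = ennreal (survival q x s u) * ennreal (q_rate q x u)"
        by (rule antisym, rule SUP_least, simp, rule SUP_upper2[of n]) (use n True in auto)
      then show ?thesis using True s by (simp only: e) (simp add: emeasure_q_tilde_space x)
    qed simp
  qed
  also have "\<dots> = (SUP n::nat. \<integral>\<^sup>+u. ?g (s + real n) u \<partial>lborel)"
  proof (rule nn_integral_monotone_convergence_SUP)
    show "incseq (\<lambda>n::nat. ?g (s + real n))"
      by (auto simp: incseq_def le_fun_def)
    fix n :: nat
    have [measurable]: "R x \<in> borel_measurable borel" by (rule R_measurable1[OF x])
    have [measurable]: "survival q x s \<in> borel_measurable borel"
      by (rule survival_measurable) (auto simp: space_restrict_space x s)
    have "?g (s + real n) = (\<lambda>u. if s < u \<and> u \<le> s + real n then ennreal (survival q x s u) * ennreal (R x u) else 0)"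
      using s by (auto simp: max_def)
    then show "?g (s + real n) \<in> borel_measurable lborel" by simp
  qed
  also have "\<dots> \<le> 1"
  proof (rule SUP_least)
    fix n :: nat
    have "(\<integral>\<^sup>+u. ?g (s + real n) u \<partial>lborel) \<le>
      (\<integral>\<^sup>+u\<in>{s..s + real n}. ennreal (survival q x s u) * ennreal (q_rate q x u) \<partial>lborel)"
      by (intro nn_integral_mono) (auto split: split_indicator)
    also have "\<dots> = ennreal (1 - survival q x s (s + real n))" by (rule survival_integral) (auto simp: x s)
    also have "\<dots> \<le> 1" by (simp add: survival_def)
    finally show "(\<integral>\<^sup>+u. ?g (s + real n) u \<partial>lborel) \<le> 1" .
  qed
  finally show ?thesis .
qed

definition defect :: "real \<Rightarrow> 'a \<Rightarrow> ennreal" where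
  "defect s x = 1 - JI s x (indicator (space (jump_space S)))"

lemma sets_jump_kernel[simp, measurable_cong]: "sets (jump_kernel S q p) = sets (jump_space S)"
  by (auto simp: jump_kernel_def split: prod.split option.split intro!: sets.sigma_sets_eq
      dest: sets.sets_into_space simp: sets.space_closed)

lemma space_jump_kernel[simp]: "space (jump_kernel S q p) = space (jump_space S)"
  by (rule sets_eq_imp_space_eq) simp

lemma jump_kernel_None: "jump_kernel S q (s, None) = return (jump_space S) (\<infinity>, None)"
  and jump_kernel_infinity: "jump_kernel S q (\<infinity>, y) = return (jump_space S) (\<infinity>, None)"
  by (auto simp: jump_kernel_def split: option.split)

lemma None_in_space: "(\<infinity>, None) \<in> space (jump_space S)"
  by (simp add: space_pair_measure space_state_space)

lemma emeasure_jump_kernel: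
  assumes x: "x \<in> S" and s: "0 \<le> s" and B: "B \<in> sets (jump_space S)"
  shows "emeasure (jump_kernel S q (ennreal s, Some x)) B =
    JI s x (indicator B) + defect s x * indicator B (\<infinity>, None)"
proof -
  let ?N = "jump_space S"
  let ?\<mu> = "\<lambda>B. jump_intensity S q s x B + (1 - jump_intensity S q s x (space ?N)) * indicator B (\<infinity>, None)"
  have K: "jump_kernel S q (ennreal s, Some x) = measure_of (space ?N) (sets ?N) ?\<mu>"
    using s by (simp add: jump_kernel_def)
  have eq: "?\<mu> B = JI s x (indicator B) + defect s x * indicator B (\<infinity>, None)" if "B \<in> sets ?N" for B
    using that by (simp add: jump_intensity_JI defect_def)
  have "emeasure (jump_kernel S q (ennreal s, Some x)) B = ?\<mu> B"
  proof (rule emeasure_measure_of[OF K])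
    show "sets ?N \<subseteq> Pow (space ?N)" by (rule sets.space_closed)
    show "B \<in> sets (jump_kernel S q (ennreal s, Some x))" using B by simp
    show "positive (sets (jump_kernel S q (ennreal s, Some x))) ?\<mu>"
      by (simp add: positive_def jump_intensity_def)
    show "countably_additive (sets (jump_kernel S q (ennreal s, Some x))) ?\<mu>"
    proof (rule countably_additiveI)
      fix A :: "nat \<Rightarrow> _" assume A: "range A \<subseteq> sets (jump_kernel S q (ennreal s, Some x))" "disjoint_family A"
        "(\<Union>i. A i) \<in> sets (jump_kernel S q (ennreal s, Some x))"
      have A': "A i \<in> sets ?N" for i using A(1) by auto
      have ind: "(\<Sum>i. indicator (A i) p) = (indicator (\<Union>i. A i) p :: ennreal)" for p
        by (rule suminf_indicator[OF A(2)])
      have "(\<Sum>i. ?\<mu> (A i)) = (\<Sum>i. JI s x (indicator (A i)) + defect s x * indicator (A i) (\<infinity>, None))"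
        by (intro suminf_cong eq A')
      also have "\<dots> = (\<Sum>i. JI s x (indicator (A i))) + (\<Sum>i. defect s x * indicator (A i) (\<infinity>, None))"
        by (intro suminf_add[symmetric]) auto
      also have "\<dots> = JI s x (indicator (\<Union>i. A i)) + defect s x * indicator (\<Union>i. A i) (\<infinity>, None)"
        using JI_suminf[of "\<lambda>i. indicator (A i)", OF _ x s] A' by (simp add: ind)
      also have "\<dots> = ?\<mu> (\<Union>i. A i)" by (rule eq[symmetric]) (use A(3) in simp)
      finally show "(\<Sum>i. ?\<mu> (A i)) = ?\<mu> (\<Union>i. A i)" .
    qed
  qed
  also have "\<dots> = JI s x (indicator B) + defect s x * indicator B (\<infinity>, None)" by (rule eq[OF B])
  finally show ?thesis .
qed

lemma jump_space_cases:
  assumes "p \<in> space (jump_space S)"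
  obtains (absorbed) "jump_kernel S q p = return (jump_space S) (\<infinity>, None)" "fst p = \<infinity> \<or> snd p = None"
  | (alive) s x where "p = (ennreal s, Some x)" "0 \<le> s" "x \<in> S"
proof (cases p)
  case (Pair t y)
  show ?thesis
  proof (cases "t = \<infinity> \<or> y = None")
    case True
    then have "jump_kernel S q p = return (jump_space S) (\<infinity>, None)"
      unfolding Pair using jump_kernel_None jump_kernel_infinity by auto
    then show ?thesis using that(1) True Pair by simp
  next
    case False
    then obtain x where "y = Some x" "x \<in> S"
      using Pair assms by (auto simp: space_pair_measure space_state_space)
    moreover have "t = ennreal (enn2real t)" using False by (simp add: less_top)
    ultimately show ?thesis using that(2)[of "enn2real t" x] Pair by simp
  qed
qed

lemma prob_space_jump_kernel: assumes "p \<in> space (jump_space S)" shows "prob_space (jump_kernel S q p)"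
  using assms
proof (cases rule: jump_space_cases)
  case absorbed
  then show ?thesis using prob_space_return[OF None_in_space] by simp
next
  case (alive s x)
  have "emeasure (jump_kernel S q p) (space (jump_kernel S q p)) =
     JI s x (indicator (space (jump_space S))) + defect s x"
    unfolding alive(1) using emeasure_jump_kernel[OF alive(3,2) sets.top] None_in_space by simp
  also have "\<dots> = 1" unfolding defect_def
    by (rule add_diff_eq_iff_ennreal[THEN iffD2]) (use JI_space_le_1 alive in auto)
  finally show ?thesis by (rule prob_spaceI)
qed

lemma jump_kernel_measurable:
  assumes "S \<noteq> {}"
  shows "jump_kernel S q \<in> measurable (jump_space S) (subprob_algebra (jump_space S))"
proof (rule measurable_subprob_algebra)
  show "subprob_space (jump_kernel S q p)" if "p \<in> space (jump_space S)" for p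
    using prob_space_jump_kernel[OF that] by (rule prob_space_imp_subprob_space)
next
  fix B assume B[measurable]: "B \<in> sets (jump_space S)"
  obtain x0 where x0: "x0 \<in> S" using assms by auto
  let ?x = "\<lambda>p. case_option x0 (\<lambda>x. x) (snd p) :: 'a" and ?s = "\<lambda>p. enn2real (fst p :: ennreal)"
  have xm[measurable]: "?x \<in> measurable (jump_space S) (borel_on S)"
    using measurable_compose[OF measurable_snd measurable_case_state_space[OF x0]] .
  have [measurable]: "(\<lambda>p. JI (?s p) (?x p) (indicator B)) \<in> borel_measurable (jump_space S)"
    by (rule JI_measurable) auto
  have [measurable]: "(\<lambda>p. JI (?s p) (?x p) (indicator (space (jump_space S)))) \<in> borel_measurable (jump_space S)"
    by (rule JI_measurable) auto
  have [measurable]: "Measurable.pred (jump_space S) (\<lambda>p. snd p = None)"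
  proof -
    have "Measurable.pred (jump_space S) (\<lambda>p. snd p \<in> {None})" by measurable
    then show ?thesis by simp
  qed
  have "(\<lambda>p. if fst p = \<infinity> \<or> snd p = None then indicator B (\<infinity>, None)
    else JI (?s p) (?x p) (indicator B) + defect (?s p) (?x p) * indicator B (\<infinity>, None)) \<in> borel_measurable (jump_space S)"
    unfolding defect_def by measurable
  also have "?this \<longleftrightarrow> (\<lambda>p. emeasure (jump_kernel S q p) B) \<in> borel_measurable (jump_space S)"
  proof (rule measurable_cong)
    fix p assume "p \<in> space (jump_space S)"
    then show "(if fst p = \<infinity> \<or> snd p = None then indicator B (\<infinity>, None)
      else JI (?s p) (?x p) (indicator B) + defect (?s p) (?x p) * indicator B (\<infinity>, None)) =
      emeasure (jump_kernel S q p) B"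
      by (cases rule: jump_space_cases) (auto simp: emeasure_jump_kernel B)
  qed
  finally show "(\<lambda>p. emeasure (jump_kernel S q p) B) \<in> borel_measurable (jump_space S)" .
qed simp

lemma Ionescu_Tulcea_jump_step:
  assumes x: "x \<in> S"
  shows "Ionescu_Tulcea (jump_step S q x) (\<lambda>_. jump_space S)"
proof -
  have s0: "(0, Some x) \<in> space (jump_space S)" using x by (simp add: space_pair_measure space_state_space)
  have A: "jump_step S q x i \<in> measurable (PiM {0..<i} (\<lambda>_. jump_space S)) (subprob_algebra (jump_space S))" for i
  proof (cases i)
    case 0
    have "return (jump_space S) (0, Some x) \<in> space (subprob_algebra (jump_space S))"
      using prob_space_return[OF s0] by (simp add: space_subprob_algebra prob_space_imp_subprob_space)
    moreover have "jump_step S q x 0 = (\<lambda>_. return (jump_space S) (0, Some x))" by (simp add: fun_eq_iff)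
    ultimately show ?thesis unfolding 0 by (simp only: measurable_const)
  next
    case (Suc n)
    have "S \<noteq> {}" using x by auto
    from jump_kernel_measurable[OF this] show ?thesis
      unfolding Suc jump_step.simps by measurable
  qed
  have B: "prob_space (jump_step S q x i \<omega>)"
    if "\<omega> \<in> space (PiM {0..<i} (\<lambda>_. jump_space S))" for i \<omega>
  proof (cases i)
    case 0 then show ?thesis using prob_space_return[OF s0] by simp
  next
    case (Suc n)
    then have "\<omega> n \<in> space (jump_space S)" using that by (auto simp: space_PiM PiE_iff)
    then show ?thesis using prob_space_jump_kernel by (simp add: Suc)
  qed
  show ?thesis by (rule Ionescu_Tulcea.intro[OF A B])
qed

end


context Q_function
begin

lemma nn_integral_jump_kernel:
  assumes x: "x \<in> S" and s: "0 \<le> s" and f: "f \<in> borel_measurable (jump_space S)"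
  shows "(\<integral>\<^sup>+p. f p \<partial>jump_kernel S q (ennreal s, Some x)) = JI s x f + defect s x * f (\<infinity>, None)"
  using f
proof (induction rule: borel_measurable_induct)
  case (cong f g)
  have "(\<integral>\<^sup>+p. f p \<partial>jump_kernel S q (ennreal s, Some x)) = (\<integral>\<^sup>+p. g p \<partial>jump_kernel S q (ennreal s, Some x))"
    by (intro nn_integral_cong) (simp add: cong)
  then show ?case using cong JI_cong[of f g s x] None_in_space by (simp only:)
next
  case (set A)
  then show ?case using x s by (simp add: emeasure_jump_kernel)
next
  case (mult u c)
  have "JI s x (\<lambda>p. c * u p) = c * JI s x u"
  proof -
    have "JI s x (\<lambda>p. c * u p) = (\<integral>\<^sup>+v. c * (if s < v then ennreal (survival q x s v) *
        (\<integral>\<^sup>+y. u (ennreal v, Some y) \<partial>q_tilde S q x (max 0 v)) else 0) \<partial>lborel)"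
      unfolding JI_R[OF s]
      by (intro nn_integral_cong) (auto simp: nn_integral_cmult[OF section_measurable[OF mult(2)]] ac_simps)
    also have "\<dots> = c * JI s x u"
      unfolding JI_R[OF s] using JI_body_measurable1[OF mult(2) x s] by (intro nn_integral_cmult) simp
    finally show ?thesis .
  qed
  then show ?case using mult by (simp add: nn_integral_cmult distrib_left ac_simps)
next
  case (add u v)
  have "JI s x (\<lambda>p. v p + u p) = JI s x v + JI s x u"
  proof -
    have "JI s x (\<lambda>p. v p + u p) = (\<integral>\<^sup>+w. (if s < w then ennreal (survival q x s w) *
        (\<integral>\<^sup>+y. v (ennreal w, Some y) \<partial>q_tilde S q x (max 0 w)) else 0) + (if s < w then ennreal (survival q x s w) *
        (\<integral>\<^sup>+y. u (ennreal w, Some y) \<partial>q_tilde S q x (max 0 w)) else 0) \<partial>lborel)"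
      unfolding JI_R[OF s]
      by (intro nn_integral_cong)
         (auto simp: nn_integral_add[OF section_measurable[OF add(3)] section_measurable[OF add(1)]] distrib_left)
    also have "\<dots> = JI s x v + JI s x u"
      unfolding JI_R[OF s] using JI_body_measurable1[OF add(1) x s] JI_body_measurable1[OF add(3) x s]
      by (intro nn_integral_add) auto
    finally show ?thesis .
  qed
  then show ?case using add by (simp add: nn_integral_add distrib_left ac_simps)
next
  case (seq U)
  have f: "(SUP i. U i) = (\<lambda>p. SUP i. U i p)" by (auto simp: fun_eq_iff image_comp)
  have "JI s x (\<lambda>p. SUP i. U i p) = (SUP i. JI s x (U i))"
  proof -
    let ?b = "\<lambda>i w. (if s < w then ennreal (survival q x s w) *
        (\<integral>\<^sup>+y. U i (ennreal w, Some y) \<partial>q_tilde S q x (max 0 w)) else 0)"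
    have "JI s x (\<lambda>p. SUP i. U i p) = (\<integral>\<^sup>+w. (SUP i. ?b i w) \<partial>lborel)"
      unfolding JI_R[OF s]
    proof (intro nn_integral_cong)
      fix w
      have "(\<integral>\<^sup>+y. (SUP i. U i (ennreal w, Some y)) \<partial>q_tilde S q x (max 0 w)) =
        (SUP i. \<integral>\<^sup>+y. U i (ennreal w, Some y) \<partial>q_tilde S q x (max 0 w))"
        by (rule nn_integral_monotone_convergence_SUP)
           (use section_measurable[OF seq(1)] seq(3) in \<open>auto simp: incseq_def le_fun_def\<close>)
      then show "(if s < w then ennreal (survival q x s w) *
        (\<integral>\<^sup>+y. (SUP i. U i (ennreal w, Some y)) \<partial>q_tilde S q x (max 0 w)) else 0) = (SUP i. ?b i w)"
        by (simp add: SUP_mult_left_ennreal)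
    qed
    also have "\<dots> = (SUP i. \<integral>\<^sup>+w. ?b i w \<partial>lborel)"
    proof (rule nn_integral_monotone_convergence_SUP)
      show "incseq ?b" using seq(3)
        by (auto simp: incseq_def le_fun_def intro!: mult_left_mono nn_integral_mono)
      show "?b i \<in> borel_measurable lborel" for i
        using JI_body_measurable1[OF seq(1) x s] by simp
    qed
    finally show ?thesis unfolding JI_R[OF s] .
  qed
  moreover have "incseq (\<lambda>i. JI s x (U i))"
    using seq(3) by (auto simp: incseq_def le_fun_def intro!: JI_mono)
  moreover have "incseq (\<lambda>i. defect s x * U i (\<infinity>, None))"
    using seq(3) by (auto simp: incseq_def le_fun_def intro!: mult_left_mono)
  ultimately have "JI s x (\<lambda>p. SUP i. U i p) + defect s x * (SUP i. U i (\<infinity>, None)) =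
     (SUP i. JI s x (U i) + defect s x * U i (\<infinity>, None))"
    by (simp only: SUP_mult_left_ennreal ennreal_SUP_add)
  moreover have "(\<integral>\<^sup>+p. (SUP i. U i p) \<partial>jump_kernel S q (ennreal s, Some x)) =
      (SUP i. \<integral>\<^sup>+p. U i p \<partial>jump_kernel S q (ennreal s, Some x))"
    using seq by (intro nn_integral_monotone_convergence_SUP) auto
  ultimately show ?case unfolding f by (simp only: seq.IH)
qed

context
  fixes x assumes x: "x \<in> S"
begin

abbreviation (input) JL :: "(nat \<Rightarrow> ennreal \<times> 'a option) measure" where "JL \<equiv> jump_law S q x"
abbreviation (input) CC :: "nat \<Rightarrow> (nat \<Rightarrow> ennreal \<times> 'a option) measure" where
  "CC n \<equiv> Ionescu_Tulcea.C (jump_step S q x) (\<lambda>_. jump_space S) 0 n (\<lambda>_. undefined)"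

interpretation IT: Ionescu_Tulcea "jump_step S q x" "\<lambda>_. jump_space S"
  by (rule Ionescu_Tulcea_jump_step[OF x])

lemma sets_jump_law[simp, measurable_cong]: "sets (jump_law S q x) = sets (PiM UNIV (\<lambda>_. jump_space S))"
  by (simp add: jump_law_def)

lemma space_jump_law[simp]: "space (jump_law S q x) = space (PiM UNIV (\<lambda>_. jump_space S))"
  by (rule sets_eq_imp_space_eq) simp

lemma restrict_measurable: "(\<lambda>\<omega>. restrict \<omega> {0..<n::nat}) \<in> measurable JL (PiM {0..<n} (\<lambda>_. jump_space S))"
  by measurable

lemma distr_jump_law: "distr JL (PiM {0..<n} (\<lambda>_. jump_space S)) (\<lambda>\<omega>. restrict \<omega> {0..<n}) = CC n"
proof -
  have "IT.up_to {0..<n} \<le> n" "n \<le> IT.up_to {0..<n}"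
    using IT.up_to[of "{0..<n}"] by (auto simp: IT.up_to_iff)
  then have u: "IT.up_to {0..<n} = n" by simp
  have "distr JL (PiM {0..<n} (\<lambda>_. jump_space S)) (\<lambda>\<omega>. restrict \<omega> {0..<n}) = IT.CI {0..<n}"
    unfolding jump_law_def by (rule IT.distr_lim) simp
  also have "\<dots> = CC n"
    unfolding IT.CI_def u using IT.distr_C[of n n "\<lambda>_. undefined" 0] by (simp add: space_PiM)
  finally show ?thesis .
qed

lemma nn_integral_jump_law:
  assumes "F \<in> borel_measurable (PiM {0..<n} (\<lambda>_. jump_space S))"
  shows "(\<integral>\<^sup>+\<omega>. F (restrict \<omega> {0..<n}) \<partial>JL) = (\<integral>\<^sup>+\<omega>. F \<omega> \<partial>CC n)"
  unfolding distr_jump_law[symmetric]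
  by (rule nn_integral_distr[symmetric, OF restrict_measurable]) (simp add: assms)

lemma prob_space_jump_law: "prob_space (jump_law S q x)"
proof -
  have "prob_space (distr JL (PiM {0..<0} (\<lambda>_. jump_space S)) (\<lambda>\<omega>. restrict \<omega> {0..<0}))"
    unfolding distr_jump_law by (rule IT.prob_space_C) (simp add: space_PiM)
  then show ?thesis by (rule prob_space_distrD[OF restrict_measurable])
qed

lemma nn_integral_CC_Suc:
  assumes F[measurable]: "F \<in> borel_measurable (PiM {0..<Suc n} (\<lambda>_. jump_space S))"
  shows "(\<integral>\<^sup>+\<omega>. F \<omega> \<partial>CC (Suc n)) = (\<integral>\<^sup>+\<omega>. (\<integral>\<^sup>+p. F (fun_upd \<omega> n p) \<partial>jump_step S q x n \<omega>) \<partial>CC n)"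
proof -
  have u: "(\<lambda>_. undefined) \<in> space (PiM {0..<0::nat} (\<lambda>_. jump_space S))" by (simp add: space_PiM)
  have "(\<integral>\<^sup>+\<omega>. F \<omega> \<partial>CC (Suc n)) = (\<integral>\<^sup>+\<omega>. (\<integral>\<^sup>+\<omega>'. F \<omega>' \<partial>IT.eP n \<omega>) \<partial>CC n)"
    unfolding IT.C.simps
  proof (subst nn_integral_bind[where B="PiM {0..<Suc n} (\<lambda>_. jump_space S)"])
    show "IT.eP (0 + n) \<in> CC n \<rightarrow>\<^sub>M subprob_algebra (PiM {0..<Suc n} (\<lambda>_. jump_space S))"
      using IT.measurable_eP[of n] by (simp add: measurable_cong_sets[OF IT.sets_C[OF u] refl])
  qed simp_all
  also have "\<dots> = (\<integral>\<^sup>+\<omega>. (\<integral>\<^sup>+p. F (fun_upd \<omega> n p) \<partial>jump_step S q x n \<omega>) \<partial>CC n)"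
    by (intro nn_integral_cong IT.nn_integral_eP[OF _ F]) (simp add: IT.space_C[OF u])
  finally show ?thesis .
qed

lemma jump_law_0: "AE \<omega> in JL. \<omega> 0 = (0, Some x)"
proof -
  let ?N = "PiM {0..<Suc 0} (\<lambda>_. jump_space S)"
  have s0: "(0, Some x) \<in> space (jump_space S)" using x by (simp add: space_pair_measure space_state_space)
  have Some_x: "{Some x} \<in> sets (state_space S)"
    using Some_image_sets[of "{x}" S] x by (simp add: sets_borel_on)
  have "{0::ennreal} \<times> {Some x} \<in> sets (jump_space S)" using Some_x by (intro pair_measureI) auto
  then have A[measurable]: "{(0::ennreal, Some x)} \<in> sets (jump_space S)" by simp
  let ?F = "\<lambda>\<omega>. indicator (- {(0, Some x)}) (\<omega> 0) :: ennreal"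
  have "?F = (\<lambda>\<omega>. 1 - indicator {(0, Some x)} (\<omega> 0))" by (auto split: split_indicator)
  then have F: "?F \<in> borel_measurable ?N" "?F \<in> borel_measurable JL" by simp_all
  have F1: "(\<lambda>p. indicator (- {(0, Some x)}) p :: ennreal) \<in> borel_measurable (jump_space S)"
  proof -
    have "(\<lambda>p. indicator (- {(0, Some x)}) p :: ennreal) = (\<lambda>p. 1 - indicator {(0, Some x)} p)"
      by (auto split: split_indicator)
    then show ?thesis by simp
  qed
  have "(\<integral>\<^sup>+\<omega>. ?F \<omega> \<partial>JL) = (\<integral>\<^sup>+\<omega>. ?F (restrict \<omega> {0..<Suc 0}) \<partial>JL)" by simp
  also have "\<dots> = (\<integral>\<^sup>+\<omega>. ?F \<omega> \<partial>CC (Suc 0))" by (rule nn_integral_jump_law[OF F(1)])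
  also have "\<dots> = (\<integral>\<^sup>+\<omega>. (\<integral>\<^sup>+p. ?F (fun_upd \<omega> 0 p) \<partial>jump_step S q x 0 \<omega>) \<partial>CC 0)" by (rule nn_integral_CC_Suc[OF F(1)])
  also have "\<dots> = 0" using nn_integral_return[OF s0 F1] by simp
  finally have "AE \<omega> in JL. ?F \<omega> = 0" using F(2) by (subst (asm) nn_integral_0_iff_AE) auto
  then show ?thesis by eventually_elim (auto split: split_indicator_asm)
qed

text \<open>The defining property of the law: conditionally on the first \<open>n + 1\<close> pairs, the next one has law \<open>jump_kernel S q (\<omega> n)\<close>.\<close>

lemma jump_law_Suc:
  assumes H[measurable]: "case_prod H \<in> borel_measurable (PiM {0..<Suc n} (\<lambda>_. jump_space S) \<Otimes>\<^sub>M jump_space S)"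
  shows "(\<integral>\<^sup>+\<omega>. H (restrict \<omega> {0..<Suc n}) (\<omega> (Suc n)) \<partial>JL) =
    (\<integral>\<^sup>+\<omega>. (\<integral>\<^sup>+p. H (restrict \<omega> {0..<Suc n}) p \<partial>jump_kernel S q (\<omega> n)) \<partial>JL)"
proof -
  have ne: "S \<noteq> {}" using x by auto
  have u: "(\<lambda>_. undefined) \<in> space (PiM {0..<0::nat} (\<lambda>_. jump_space S))" by (simp add: space_PiM)
  let ?N = "PiM {0..<Suc n} (\<lambda>_. jump_space S)" and ?N' = "PiM {0..<Suc (Suc n)} (\<lambda>_. jump_space S)"
  have "(\<lambda>\<omega>. jump_kernel S q (\<omega> n)) \<in> measurable ?N (subprob_algebra (jump_space S))"
    by (rule measurable_compose[OF _ jump_kernel_measurable[OF ne]]) simp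
  from nn_integral_measurable_subprob_algebra2[OF H this]
  have km[measurable]: "(\<lambda>\<omega>. \<integral>\<^sup>+p. H \<omega> p \<partial>jump_kernel S q (\<omega> n)) \<in> borel_measurable ?N" .
  have [measurable]: "(\<lambda>\<omega>. restrict \<omega> {0..<Suc n}) \<in> measurable ?N' ?N"
    by (rule measurable_restrict_subset) auto
  let ?F = "\<lambda>\<omega>. H (restrict \<omega> {0..<Suc n}) (\<omega> (Suc n))"
  have F: "?F \<in> borel_measurable ?N'" by measurable
  have "(\<integral>\<^sup>+\<omega>. ?F \<omega> \<partial>JL) = (\<integral>\<^sup>+\<omega>. ?F (restrict \<omega> {0..<Suc (Suc n)}) \<partial>JL)"
  proof -
    have "{0..<Suc (Suc n)} \<inter> {0..<Suc n} = {0..<Suc n}" by auto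
    then show ?thesis by (simp only: restrict_restrict) simp
  qed
  also have "\<dots> = (\<integral>\<^sup>+\<omega>. ?F \<omega> \<partial>CC (Suc (Suc n)))" by (rule nn_integral_jump_law[OF F])
  also have "\<dots> = (\<integral>\<^sup>+\<omega>. (\<integral>\<^sup>+p. ?F (fun_upd \<omega> (Suc n) p) \<partial>jump_step S q x (Suc n) \<omega>) \<partial>CC (Suc n))"
    by (rule nn_integral_CC_Suc[OF F])
  also have "\<dots> = (\<integral>\<^sup>+\<omega>. (\<integral>\<^sup>+p. H \<omega> p \<partial>jump_kernel S q (\<omega> n)) \<partial>CC (Suc n))"
  proof (rule nn_integral_cong)
    fix \<omega> assume "\<omega> \<in> space (CC (Suc n))"
    then have w: "\<omega> \<in> space ?N" using IT.space_C[OF u, of "Suc n"] by simp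
    have "restrict (fun_upd \<omega> (Suc n) p) {0..<Suc n} = \<omega>" for p
      using w by (auto simp: space_PiM PiE_iff extensional_def restrict_def fun_eq_iff)
    then show "(\<integral>\<^sup>+p. ?F (fun_upd \<omega> (Suc n) p) \<partial>jump_step S q x (Suc n) \<omega>) =
      (\<integral>\<^sup>+p. H \<omega> p \<partial>jump_kernel S q (\<omega> n))"
      by simp
  qed
  also have "\<dots> = (\<integral>\<^sup>+\<omega>. (\<integral>\<^sup>+p. H (restrict \<omega> {0..<Suc n}) p \<partial>jump_kernel S q ((restrict \<omega> {0..<Suc n}) n)) \<partial>JL)"
    by (rule nn_integral_jump_law[symmetric]) measurable
  also have "\<dots> = (\<integral>\<^sup>+\<omega>. (\<integral>\<^sup>+p. H (restrict \<omega> {0..<Suc n}) p \<partial>jump_kernel S q (\<omega> n)) \<partial>JL)"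
    by simp
  finally show ?thesis .
qed

lemma jump_law_pair:
  assumes H[measurable]: "case_prod H \<in> borel_measurable (jump_space S \<Otimes>\<^sub>M jump_space S)"
  shows "(\<integral>\<^sup>+\<omega>. H (\<omega> n) (\<omega> (Suc n)) \<partial>JL) = (\<integral>\<^sup>+\<omega>. (\<integral>\<^sup>+p. H (\<omega> n) p \<partial>jump_kernel S q (\<omega> n)) \<partial>JL)"
  using jump_law_Suc[of "\<lambda>\<omega> p. H (\<omega> n) p" n] by simp

lemma JI_not_after: assumes "0 \<le> s" shows "JI s y (\<lambda>p. if fst p < ennreal s then 1 else 0) = 0"
proof -
  have "JI s y (\<lambda>p. if fst p < ennreal s then 1 else 0) = (\<integral>\<^sup>+u. 0 \<partial>(lborel :: real measure))"
    unfolding JI_def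
  proof (rule nn_integral_cong)
    fix u
    have "\<not> (s < u \<and> ennreal u < ennreal s)" using assms by (auto simp: ennreal_less_iff)
    then show "ennreal (survival q y s u) *
         (\<integral>\<^sup>+z. (if fst (ennreal u, Some z) < ennreal s then 1 else 0) \<partial>q_tilde S q y u) * indicator {s<..} u = 0"
      by (auto split: split_indicator)
  qed
  then show ?thesis by simp
qed

lemma jump_times_incseq: "AE \<omega> in JL. incseq (\<lambda>n. fst (\<omega> n))"
proof -
  have "AE \<omega> in JL. fst (\<omega> n) \<le> fst (\<omega> (Suc n))" for n
  proof -
    let ?H = "\<lambda>p p'. if fst p' < fst p then 1 else 0 :: ennreal"
    have H: "case_prod ?H \<in> borel_measurable (jump_space S \<Otimes>\<^sub>M jump_space S)" by measurable
    have "(\<integral>\<^sup>+\<omega>. ?H (\<omega> n) (\<omega> (Suc n)) \<partial>JL) =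
        (\<integral>\<^sup>+\<omega>. (\<integral>\<^sup>+p. ?H (\<omega> n) p \<partial>jump_kernel S q (\<omega> n)) \<partial>JL)"
      by (rule jump_law_pair[OF H])
    also have "\<dots> = (\<integral>\<^sup>+\<omega>. 0 \<partial>JL)"
    proof (rule nn_integral_cong)
      fix \<omega> assume "\<omega> \<in> space JL"
      then have w: "\<omega> n \<in> space (jump_space S)" by (auto simp: space_PiM PiE_iff)
      have hm: "?H (\<omega> n) \<in> borel_measurable (jump_space S)" by measurable
      show "(\<integral>\<^sup>+p. ?H (\<omega> n) p \<partial>jump_kernel S q (\<omega> n)) = 0"
        using w
      proof (cases rule: jump_space_cases)
        case absorbed
        then show ?thesis using nn_integral_return[OF None_in_space hm] by simp
      next
        case (alive s y)
        show ?thesis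
          using nn_integral_jump_kernel[OF alive(3,2) hm] JI_not_after[OF alive(2), of y] by (simp add: alive(1) cong: if_cong)
      qed
    qed
    finally have "(\<integral>\<^sup>+\<omega>. ?H (\<omega> n) (\<omega> (Suc n)) \<partial>JL) = 0" by simp
    then have "AE \<omega> in JL. ?H (\<omega> n) (\<omega> (Suc n)) = 0"
      by (subst (asm) nn_integral_0_iff_AE) auto
    then show ?thesis by eventually_elim (auto simp: not_less split: if_splits)
  qed
  then have "AE \<omega> in JL. \<forall>n. fst (\<omega> n) \<le> fst (\<omega> (Suc n))" by (simp add: AE_all_countable)
  then show ?thesis by eventually_elim (auto intro: incseq_SucI)
qed

definition trunc_transition :: "real \<Rightarrow> 'a set \<Rightarrow> nat \<Rightarrow> ennreal \<times> 'a option \<Rightarrow> ennreal" where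
  "trunc_transition t \<Gamma> n p = (if fst p \<le> ennreal t then (case snd p of None \<Rightarrow> 0 | Some z \<Rightarrow> q_transition_n S q n (enn2real (fst p)) z t \<Gamma>) else 0)"

lemma trunc_transition_alive: "0 \<le> s \<Longrightarrow> 0 \<le> t \<Longrightarrow> trunc_transition t \<Gamma> n (ennreal s, Some z) = (if s \<le> t then q_transition_n S q n s z t \<Gamma> else 0)"
  by (simp add: trunc_transition_def)

lemma trunc_transition_Suc:
  assumes g[measurable]: "trunc_transition t \<Gamma> n \<in> borel_measurable (jump_space S)"
    and t: "0 \<le> t" and p: "p \<in> space (jump_space S)"
  shows "trunc_transition t \<Gamma> (Suc n) p = (\<integral>\<^sup>+p'. trunc_transition t \<Gamma> n p' \<partial>jump_kernel S q p)"
  using p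
proof (cases rule: jump_space_cases)
  case absorbed
  have "trunc_transition t \<Gamma> (Suc n) p = 0" using absorbed(2) by (auto simp: trunc_transition_def top_unique)
  moreover have "trunc_transition t \<Gamma> n (\<infinity>, None) = 0" by (simp add: trunc_transition_def)
  ultimately show ?thesis unfolding absorbed(1) nn_integral_return[OF None_in_space g] by simp
next
  case (alive s z)
  have "(\<integral>\<^sup>+p'. trunc_transition t \<Gamma> n p' \<partial>jump_kernel S q p) = JI s z (trunc_transition t \<Gamma> n)"
    unfolding alive(1) nn_integral_jump_kernel[OF alive(3,2) g] by (simp add: trunc_transition_def)
  also have "\<dots> = trunc_transition t \<Gamma> (Suc n) p"
  proof -
    have "JI s z (trunc_transition t \<Gamma> n) = (\<integral>\<^sup>+u\<in>{s..t}. ennreal (survival q z s u) *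
      (\<integral>\<^sup>+y. q_transition_n S q n u y t \<Gamma> \<partial>q_tilde S q z u) \<partial>lborel)"
      unfolding JI_def
    proof (rule nn_integral_cong_AE, use AE_lborel_singleton[of s] in eventually_elim)
      fix u assume "u \<noteq> s"
      then show "ennreal (survival q z s u) *
         (\<integral>\<^sup>+y. trunc_transition t \<Gamma> n (ennreal u, Some y) \<partial>q_tilde S q z u) * indicator {s<..} u =
         ennreal (survival q z s u) *
         (\<integral>\<^sup>+y. q_transition_n S q n u y t \<Gamma> \<partial>q_tilde S q z u) * indicator {s..t} u"
        using alive(2) t by (auto simp: trunc_transition_alive split: split_indicator)
    qed
    then show ?thesis using alive t by (auto simp: trunc_transition_alive)
  qed
  finally show ?thesis ..
qed

lemma trunc_transition_measurable:
  assumes \<Gamma>[measurable]: "\<Gamma> \<in> sets (borel_on S)" and t: "0 \<le> t"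
  shows "trunc_transition t \<Gamma> n \<in> borel_measurable (jump_space S)"
proof (induction n)
  case 0
  let ?x = "\<lambda>p. case_option x (\<lambda>x. x) (snd p) :: 'a" and ?s = "\<lambda>p. enn2real (fst p :: ennreal)"
  have xm[measurable]: "?x \<in> measurable (jump_space S) (borel_on S)"
    using measurable_compose[OF measurable_snd measurable_case_state_space[OF x]] .
  have [measurable]: "(\<lambda>p. survival q (?x p) (?s p) t) \<in> borel_measurable (jump_space S)"
    by (rule survival_measurable) auto
  have [measurable]: "Measurable.pred (jump_space S) (\<lambda>p. snd p = None)"
  proof -
    have "Measurable.pred (jump_space S) (\<lambda>p. snd p \<in> {None})" by measurable
    then show ?thesis by simp
  qed
  have "trunc_transition t \<Gamma> 0 = (\<lambda>p. if fst p \<le> ennreal t \<and> snd p \<noteq> None then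
      indicator \<Gamma> (?x p) * ennreal (survival q (?x p) (?s p) t) else 0)"
    by (auto simp: trunc_transition_def fun_eq_iff split: option.split)
  moreover have "(\<lambda>p. if fst p \<le> ennreal t \<and> snd p \<noteq> None then
      indicator \<Gamma> (?x p) * ennreal (survival q (?x p) (?s p) t) else 0) \<in> borel_measurable (jump_space S)"
    by measurable
  ultimately show ?case by (simp only:)
next
  case (Suc n)
  have "S \<noteq> {}" using x by auto
  then have "(\<lambda>p. \<integral>\<^sup>+p'. trunc_transition t \<Gamma> n p' \<partial>jump_kernel S q p) \<in> borel_measurable (jump_space S)"
    by (rule measurable_compose[OF jump_kernel_measurable nn_integral_measurable_subprob_algebra]) (use Suc in simp)
  also have "?this \<longleftrightarrow> ?case" by (rule measurable_cong) (simp add: trunc_transition_Suc[OF Suc t])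
  finally show ?case .
qed

lemma jump_law_g:
  assumes \<Gamma>: "\<Gamma> \<in> sets (borel_on S)" and t: "0 \<le> t"
  shows "(\<integral>\<^sup>+\<omega>. trunc_transition t \<Gamma> k (\<omega> n) \<partial>JL) = q_transition_n S q (k + n) 0 x t \<Gamma>"
proof (induction n arbitrary: k)
  case 0
  interpret JL: prob_space JL by (rule prob_space_jump_law)
  have "(\<integral>\<^sup>+\<omega>. trunc_transition t \<Gamma> k (\<omega> 0) \<partial>JL) = (\<integral>\<^sup>+\<omega>. q_transition_n S q k 0 x t \<Gamma> \<partial>JL)"
    by (rule nn_integral_cong_AE, use jump_law_0 in eventually_elim) (simp add: trunc_transition_def)
  then show ?case using JL.emeasure_space_1 by simp
next
  case (Suc n)
  note trunc_transition_measurable[OF \<Gamma> t, measurable]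
  have "(\<integral>\<^sup>+\<omega>. trunc_transition t \<Gamma> k (\<omega> (Suc n)) \<partial>JL) = (\<integral>\<^sup>+\<omega>. (\<integral>\<^sup>+p. trunc_transition t \<Gamma> k p \<partial>jump_kernel S q (\<omega> n)) \<partial>JL)"
    by (rule jump_law_pair[of "\<lambda>_. trunc_transition t \<Gamma> k"]) measurable
  also have "\<dots> = (\<integral>\<^sup>+\<omega>. trunc_transition t \<Gamma> (Suc k) (\<omega> n) \<partial>JL)"
    by (intro nn_integral_cong trunc_transition_Suc[symmetric] t trunc_transition_measurable \<Gamma>) (auto simp: space_PiM PiE_iff)
  finally show ?case using Suc[of "Suc k"] by simp
qed

lemma jump_kernel_after:
  assumes \<Gamma>: "\<Gamma> \<in> sets (borel_on S)" and t: "0 \<le> t" and p: "p \<in> space (jump_space S)"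
  shows "(\<integral>\<^sup>+p'. (if fst p \<le> ennreal t \<and> ennreal t < fst p' \<and> snd p \<in> Some ` \<Gamma> then 1 else 0) \<partial>jump_kernel S q p) = trunc_transition t \<Gamma> 0 p"
  (is "(\<integral>\<^sup>+p'. ?f p' \<partial>_) = _")
proof -
  have f: "?f \<in> borel_measurable (jump_space S)" by measurable
  show ?thesis
    using p
  proof (cases rule: jump_space_cases)
    case absorbed
    then have "?f p' = 0" for p' by (auto simp: top_unique)
    moreover have "trunc_transition t \<Gamma> 0 p = 0" using absorbed(2) by (auto simp: trunc_transition_def top_unique)
    ultimately show ?thesis by simp
  next
    case (alive s z)
    show ?thesis
    proof (cases "s \<le> t \<and> z \<in> \<Gamma>")
      case False
      then have "?f p' = 0" for p' using t alive(2) by (auto simp: alive(1))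
      moreover have "trunc_transition t \<Gamma> 0 p = 0" using False t alive by (auto simp: trunc_transition_alive)
      ultimately show ?thesis by simp
    next
      case True
      let ?B = "{..ennreal t} \<times> space (state_space S)"
      have B: "?B \<in> sets (jump_space S)" by (intro pair_measureI) auto
      interpret K: prob_space "jump_kernel S q p" by (rule prob_space_jump_kernel[OF p])
      have "(\<integral>\<^sup>+p'. ?f p' \<partial>jump_kernel S q p) = (\<integral>\<^sup>+p'. indicator (space (jump_kernel S q p) - ?B) p' \<partial>jump_kernel S q p)"
        by (rule nn_integral_cong) (use True t alive(2) in \<open>auto simp: alive(1) space_pair_measure split: split_indicator\<close>)
      also have "\<dots> = emeasure (jump_kernel S q p) (space (jump_kernel S q p) - ?B)"
        using B by (intro nn_integral_indicator) auto
      also have "\<dots> = 1 - emeasure (jump_kernel S q p) ?B"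
        using B sets.sets_into_space[OF B] K.emeasure_space_1 by (subst emeasure_compl) auto
      also have "emeasure (jump_kernel S q p) ?B = JI s z (indicator ?B)"
        unfolding alive(1) emeasure_jump_kernel[OF alive(3,2) B] by (simp add: top_unique)
      also have "\<dots> = ennreal (1 - survival q z s t)"
        by (rule JI_upto) (use alive True in auto)
      also have "1 - ennreal (1 - survival q z s t) = ennreal (survival q z s t)"
        using survival_le_1[OF alive(3,2), of t] by (subst ennreal_1[symmetric], subst ennreal_minus) auto
      finally show ?thesis using True t alive by (simp add: trunc_transition_alive)
    qed
  qed
qed

lemma jump_process_measurable: "jump_process t \<in> measurable JL (state_space S)"
proof -
  have P[measurable]: "Measurable.pred JL (\<lambda>\<omega>. fst (\<omega> n) \<le> ennreal t \<and> ennreal t < fst (\<omega> (Suc n)))" for n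
    by measurable
  have L: "(\<lambda>\<omega>. LEAST n. fst (\<omega> n) \<le> ennreal t \<and> ennreal t < fst (\<omega> (Suc n))) \<in> measurable JL (count_space UNIV)"
    by (rule measurable_Least) (rule P)
  have sn: "(\<lambda>\<omega>. snd (\<omega> n)) \<in> measurable JL (state_space S)" for n
    by measurable
  have E: "Measurable.pred JL (\<lambda>\<omega>. \<exists>n. fst (\<omega> n) \<le> ennreal t \<and> ennreal t < fst (\<omega> (Suc n)))"
    by measurable
  show ?thesis unfolding jump_process_def[abs_def]
    by (rule measurable_If[OF measurable_compose_countable[OF sn L] _ E[unfolded pred_def]])
       (simp add: space_state_space)
qed

text \<open>\<open>P\<^sub>q\<close> gives the distribution of \<open>X\<^sub>t\<close> under \<open>\<P>\<^sub>x\<^sup>q\<close>.\<close>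

lemma jump_process_distribution:
  assumes \<Gamma>[measurable]: "\<Gamma> \<in> sets (borel_on S)" and t: "0 \<le> t"
  shows "emeasure JL {\<omega> \<in> space JL. jump_process t \<omega> \<in> Some ` \<Gamma>} = q_transition S q 0 x t \<Gamma>"
proof -
  note Some_image_sets[OF \<Gamma>, measurable]
  note jump_process_measurable[measurable]
  let ?c = "\<lambda>n \<omega>. fst (\<omega> n :: ennreal \<times> 'a option) \<le> ennreal t \<and> ennreal t < fst (\<omega> (Suc n))"
  let ?H = "\<lambda>p p'. if fst p \<le> ennreal t \<and> ennreal t < fst p' \<and> snd p \<in> Some ` \<Gamma> then 1 else 0 :: ennreal"
  have H: "case_prod ?H \<in> borel_measurable (jump_space S \<Otimes>\<^sub>M jump_space S)" by measurable
  have "emeasure JL {\<omega> \<in> space JL. jump_process t \<omega> \<in> Some ` \<Gamma>} =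
     (\<integral>\<^sup>+\<omega>. indicator {\<omega> \<in> space JL. jump_process t \<omega> \<in> Some ` \<Gamma>} \<omega> \<partial>JL)"
    by (rule nn_integral_indicator[symmetric]) measurable
  also have "\<dots> = (\<integral>\<^sup>+\<omega>. (\<Sum>n. ?H (\<omega> n) (\<omega> (Suc n))) \<partial>JL)"
  proof (rule nn_integral_cong_AE, use jump_times_incseq AE_space in eventually_elim)
    fix \<omega> assume inc: "incseq (\<lambda>n. fst (\<omega> n))" and sp: "\<omega> \<in> space JL"
    show "indicator {\<omega> \<in> space JL. jump_process t \<omega> \<in> Some ` \<Gamma>} \<omega> = (\<Sum>n. ?H (\<omega> n) (\<omega> (Suc n)))"
    proof (cases "\<exists>n. ?c n \<omega>")
      case False
      then have "?H (\<omega> n) (\<omega> (Suc n)) = 0" for n by auto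
      moreover have "jump_process t \<omega> = None" unfolding jump_process_def using False by (simp only: if_False)
      ultimately show ?thesis by (auto split: split_indicator)
    next
      case True
      then obtain n where n: "?c n \<omega>" by blast
      have uniq: "m = n" if "?c m \<omega>" for m
      proof (rule ccontr)
        assume "m \<noteq> n"
        then consider "Suc m \<le> n" | "Suc n \<le> m" by linarith
        then show False
          using n that incseqD[OF inc, of "Suc m" n] incseqD[OF inc, of "Suc n" m]
          by cases (auto dest: less_le_trans order_trans)
      qed
      have "(LEAST m. ?c m \<omega>) = n" by (rule Least_equality[where P="\<lambda>m. ?c m \<omega>", OF n]) (metis uniq order_refl)
      then have jp: "jump_process t \<omega> = snd (\<omega> n)" unfolding jump_process_def using True by (simp only: if_True)
      have "(\<Sum>m. ?H (\<omega> m) (\<omega> (Suc m))) = (\<Sum>m\<in>{n}. ?H (\<omega> m) (\<omega> (Suc m)))"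
      proof (rule suminf_finite)
        fix m assume "m \<notin> {n}"
        then have "\<not> ?c m \<omega>" using uniq[of m] by blast
        then show "?H (\<omega> m) (\<omega> (Suc m)) = 0" by (simp only: de_Morgan_conj) auto
      qed simp
      then show ?thesis using n sp by (auto simp: jp split: split_indicator)
    qed
  qed
  also have "\<dots> = (\<Sum>n. \<integral>\<^sup>+\<omega>. ?H (\<omega> n) (\<omega> (Suc n)) \<partial>JL)"
    by (rule nn_integral_suminf) measurable
  also have "\<dots> = (\<Sum>n. \<integral>\<^sup>+\<omega>. trunc_transition t \<Gamma> 0 (\<omega> n) \<partial>JL)"
    by (intro suminf_cong, subst jump_law_pair[OF H])
       (intro nn_integral_cong jump_kernel_after \<Gamma> t, auto simp: space_PiM PiE_iff)
  also have "\<dots> = q_transition S q 0 x t \<Gamma>"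
    unfolding q_transition_def by (simp add: jump_law_g[OF \<Gamma> t])
  finally show ?thesis .
qed

end

end

end

theory Submission
  imports Defs
begin

text \<open>
  Fix \<open>T > 0\<close> and put \<open>W(s, x) = e\<^sup>-\<^sup>\<alpha>\<^sup>s V(s, x)\<close> for \<open>s \<le> T\<close>, and \<open>W = 0\<close> afterwards and at
  the cemetery. Condition (d) says that \<open>W\<close> is excessive for the kernel \<open>K\<close> of the chain
  \<open>(t\<^sub>n, x\<^sub>n)\<close>. Given \<open>\<epsilon> > 0\<close>, (b) yields \<open>m\<close> with \<open>\<epsilon> W \<ge> 1\<close> off \<open>S\<^sub>m\<close> up to time \<open>T\<close>, and by (c)
  the probability of a jump from \<open>S\<^sub>m\<close> before \<open>T\<close> is at most some \<open>\<theta> < 1\<close>. Hence the functions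
  \<open>B\<^sub>k = min 1 (\<theta>\<^sup>k 1\<^bsub>s \<le> T\<^esub> + \<epsilon> W)\<close> satisfy \<open>K B\<^sub>k \<le> B\<^bsub>k+1\<^esub>\<close>: on \<open>S\<^sub>m\<close> the first summand contracts,
  off \<open>S\<^sub>m\<close> the right-hand side is \<open>1\<close>. Iterating, \<open>P(t\<^sub>n \<le> T) \<le> B\<^sub>n(0, x) \<le> \<theta>\<^sup>n + \<epsilon> V(0, x)\<close>;
  let \<open>n \<rightarrow> \<infinity>\<close> and then \<open>\<epsilon> \<rightarrow> 0\<close>.
\<close>

section \<open>Test functions on pairs of jump time and state\<close>

text \<open>Cutting off past \<open>T\<close> makes the integral over all later jumps match the
  range \<open>{0..T - v}\<close> of condition (d), and the value zero at the cemetery removes the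
  contribution of absorption.\<close>

definition potential ::
  "(real \<Rightarrow> 'a \<Rightarrow> real) \<Rightarrow> real \<Rightarrow> real \<Rightarrow> ennreal \<times> 'a option \<Rightarrow> ennreal" where
  "potential V \<alpha> T p = (if fst p \<le> ennreal T then (case snd p of None \<Rightarrow> 0
      | Some x \<Rightarrow> ennreal (exp (- \<alpha> * enn2real (fst p)) * V (enn2real (fst p)) x)) else 0)"

definition before :: "real \<Rightarrow> ennreal \<times> 'a option \<Rightarrow> ennreal" where
  "before T p = (if fst p \<le> ennreal T then 1 else 0)"

definition barrier ::
  "(real \<Rightarrow> 'a \<Rightarrow> real) \<Rightarrow> real \<Rightarrow> real \<Rightarrow> real \<Rightarrow> real \<Rightarrow> nat \<Rightarrow> ennreal \<times> 'a option \<Rightarrow> ennreal" where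
  "barrier V \<alpha> T \<theta> \<epsilon> k p = min 1 (ennreal (\<theta> ^ k) * before T p + ennreal \<epsilon> * potential V \<alpha> T p)"

lemma before_measurable [measurable]: "before T \<in> borel_measurable (jump_space S)"
  unfolding before_def[abs_def] by measurable

text \<open>\<open>lim\<close> has a known value only once convergence is established; monotonicity
  makes it the supremum, which lies above every natural number.\<close>

lemma incseq_lim_eq_infinity:
  fixes f :: "nat \<Rightarrow> ennreal"
  assumes "incseq f" "\<And>m::nat. \<exists>n. ennreal (real (Suc m)) < f n"
  shows "lim f = \<infinity>"
proof -
  have "(SUP n. f n) = top"
  proof (rule ccontr)
    assume "(SUP n. f n) \<noteq> top"
    then obtain m :: nat where m: "(SUP n. f n) < of_nat m"
      using ennreal_Ex_less_of_nat by (metis top.not_eq_extremum)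
    obtain n where "ennreal (real (Suc m)) < f n" using assms(2) by blast
    also have "f n \<le> (SUP n. f n)" by (rule SUP_upper) simp
    also note m
    finally show False by (simp add: ennreal_of_nat_eq_real_of_nat ennreal_less_iff)
  qed
  then show ?thesis using LIMSEQ_SUP[OF assms(1)] limI by fastforce
qed

section \<open>Survival function: uniform lower bound and time shift\<close>

context Q_function
begin

text \<open>The accumulated rate over \<open>{s..T}\<close> is at most \<open>K * (T - s)\<close>.
  Weakening this to \<open>K * T\<close> gives a bound independent of \<open>s\<close> and
  \<open>x\<close>, which later yields one contraction factor for a whole set of states.\<close>

lemma survival_ge:
  assumes x: "x \<in> S" and s: "0 \<le> s" "s \<le> T" and K: "0 \<le> K" "\<And>v. v \<in> {0..T} \<Longrightarrow> q_rate q x v \<le> K"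
  shows "exp (- K * T) \<le> survival q x s T"
proof -
  have "(LBINT v:{s..T}. R x v) \<le> (LBINT v:{s..T}. K)"
  proof (rule set_integral_mono)
    show "set_integrable lborel {s..T} (\<lambda>_. K)"
      unfolding set_integrable_def by (intro integrable_scaleR_left) (simp add: emeasure_lborel_Icc_eq)
  qed (use x s K in \<open>auto simp: R_set_integrable\<close>)
  also have "\<dots> = K * (T - s)" using s by (simp add: set_lebesgue_integral_def)
  also have "\<dots> \<le> K * T" using s K by (intro mult_left_mono) auto
  finally show ?thesis using s by (simp add: survival_R)
qed

text \<open>Passes from absolute time, used by the kernel, to elapsed time, used in condition (d),
  by the substitution \<open>u = v + s\<close>.\<close>

lemma survival_shift:
  assumes "0 \<le> v"
  shows "survival q x v (v + t) = exp (- (LBINT s:{0..t}. q_rate q x (s + v)))"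
proof -
  have "(LBINT u:{v..v + t}. q_rate q x u) =
      (LINT s|lborel. indicator {v..v + t} (v + 1 * s) * q_rate q x (v + 1 * s))"
    unfolding set_lebesgue_integral_def by (subst lborel_integral_real_affine[where c=1 and t=v]) auto
  also have "\<dots> = (LBINT s:{0..t}. q_rate q x (s + v))"
    unfolding set_lebesgue_integral_def
    by (rule Bochner_Integration.integral_cong) (auto simp: add.commute split: split_indicator)
  finally show ?thesis by (simp add: survival_def)
qed

section \<open>The potential is excessive for the jump kernel\<close>

lemma potential_measurable:
  assumes x0: "x0 \<in> S"
    and V: "(\<lambda>(v, x). V v x) \<in> borel_measurable (borel_on {0..} \<Otimes>\<^sub>M borel_on S)"
  shows "potential V \<alpha> T \<in> borel_measurable (jump_space S)"
proof -
  \<comment> \<open>The state \<open>x0\<close> stands in for the cemetery, where the potential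
    vanishes anyway, so that \<open>V\<close> is evaluated at a measurable map into
    \<open>S\<close>.\<close>
  let ?x = "\<lambda>p. case_option x0 (\<lambda>x. x) (snd p) :: 'a" and ?s = "\<lambda>p. enn2real (fst p :: ennreal)"
  have x: "?x \<in> measurable (jump_space S) (borel_on S)"
    using measurable_compose[OF measurable_snd measurable_case_state_space[OF x0]] .
  have s: "?s \<in> measurable (jump_space S) (borel_on {0..})"
    by (intro measurable_restrict_space2) auto
  have [measurable]: "(\<lambda>p. V (?s p) (?x p)) \<in> borel_measurable (jump_space S)"
    using measurable_compose[OF measurable_Pair[OF s x] V] by simp
  have [measurable]: "Measurable.pred (jump_space S) (\<lambda>p. snd p = None)"
  proof -
    have "Measurable.pred (jump_space S) (\<lambda>p. snd p \<in> {None})" by measurable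
    then show ?thesis by simp
  qed
  have "potential V \<alpha> T = (\<lambda>p. if fst p \<le> ennreal T \<and> snd p \<noteq> None
      then ennreal (exp (- \<alpha> * ?s p) * V (?s p) (?x p)) else 0)"
    by (auto simp: potential_def fun_eq_iff split: option.split)
  moreover have "(\<lambda>p. if fst p \<le> ennreal T \<and> snd p \<noteq> None
      then ennreal (exp (- \<alpha> * ?s p) * V (?s p) (?x p)) else 0) \<in> borel_measurable (jump_space S)"
    by measurable
  ultimately show ?thesis by simp
qed

lemma potential_alive:
  "0 \<le> s \<Longrightarrow> s \<le> T \<Longrightarrow> potential V \<alpha> T (ennreal s, Some x) = ennreal (exp (- \<alpha> * s) * V s x)"
  by (auto simp: potential_def)

lemma potential_late: "0 \<le> T \<Longrightarrow> T < s \<Longrightarrow> potential V \<alpha> T (ennreal s, y) = 0"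
  by (auto simp: potential_def)

lemma before_alive: "0 \<le> T \<Longrightarrow> before T (ennreal s, y) = (if s \<le> T then 1 else 0)"
  by (auto simp: before_def)

lemma JI_before:
  assumes "x \<in> S" "0 \<le> s" "s \<le> T"
  shows "JI s x (before T) = ennreal (1 - survival q x s T)"
proof -
  have "JI s x (before T) = JI s x (indicator ({..ennreal T} \<times> space (state_space S)))"
    by (rule JI_cong) (auto simp: before_def space_pair_measure)
  then show ?thesis using JI_upto assms by simp
qed

lemma JI_late:
  assumes "0 \<le> T" "T < s" "\<And>u y. T < u \<Longrightarrow> f (ennreal u, Some y) = 0"
  shows "JI s x f = 0"
proof -
  have "JI s x f = (\<integral>\<^sup>+u. 0 \<partial>(lborel :: real measure))"
    unfolding JI_def using assms by (intro nn_integral_cong) (auto split: split_indicator)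
  then show ?thesis by simp
qed

text \<open>Substitute \<open>u = s + t\<close> and multiply by \<open>exp (\<alpha> * s)\<close>:
  the discount \<open>exp (- \<alpha> * (s + t))\<close> becomes
  \<open>exp (- \<alpha> * t)\<close>, and the jump integral turns into the left-hand side of
  \<open>drift\<close>.\<close>

lemma JI_potential_le:
  assumes x: "x \<in> S" and s: "0 \<le> s" "s \<le> T"
    and V: "(\<lambda>(v, x). V v x) \<in> borel_measurable (borel_on {0..} \<Otimes>\<^sub>M borel_on S)"
    and drift: "(\<integral>\<^sup>+t\<in>{0..T - s}. (\<integral>\<^sup>+y. ennreal (V (t + s) y *
          exp (- \<alpha> * t - (LBINT r:{0..t}. q_rate q x (r + s)))) \<partial>q_tilde S q x (t + s)) \<partial>lborel)
        \<le> ennreal (V s x)"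
  shows "JI s x (potential V \<alpha> T) \<le> potential V \<alpha> T (ennreal s, Some x)"
proof -
  let ?W = "potential V \<alpha> T"
  let ?I = "\<lambda>u. if s < u then ennreal (survival q x s u) *
      (\<integral>\<^sup>+y. ?W (ennreal u, Some y) \<partial>q_tilde S q x (max 0 u)) else 0"
  let ?d = "\<lambda>t. \<integral>\<^sup>+y. ennreal (V (t + s) y *
          exp (- \<alpha> * t - (LBINT r:{0..t}. q_rate q x (r + s)))) \<partial>q_tilde S q x (t + s)"
  have W: "?W \<in> borel_measurable (jump_space S)" by (rule potential_measurable[OF x V])
  have Im: "?I \<in> borel_measurable borel" by (rule JI_body_measurable1[OF W x s(1)])
  have Vm: "V u \<in> borel_measurable (q_tilde S q x w)" if "0 \<le> u" for u w
    using measurable_compose[OF measurable_Pair1' V, of u] that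
    by (simp add: measurable_cong_sets[OF sets_q_tilde refl] space_restrict_space)
  \<comment> \<open>The point \<open>t = 0\<close> is excluded because jumps occur strictly after
    \<open>s\<close>, whereas \<open>drift\<close> integrates over a closed interval; it is a null
    set. The form \<open>s + 1 * t\<close> fits the affine change of variables.\<close>
  have eq: "?d t * indicator {0..T - s} t = ennreal (exp (\<alpha> * s)) * ?I (s + 1 * t)" if "t \<noteq> 0" for t
  proof (cases "0 < t \<and> t \<le> T - s")
    case True
    let ?E = "exp (- (LBINT r:{0..t}. q_rate q x (r + s)))"
    have t: "0 \<le> t + s" "max 0 (s + t) = t + s" using True s by auto
    have "?d t = (\<integral>\<^sup>+y. ennreal (exp (- \<alpha> * t) * ?E) * ennreal (V (t + s) y) \<partial>q_tilde S q x (t + s))"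
      by (intro nn_integral_cong, subst ennreal_mult'[symmetric])
         (auto simp: exp_add[symmetric] mult.commute)
    also have "\<dots> = ennreal (exp (- \<alpha> * t) * ?E) * (\<integral>\<^sup>+y. ennreal (V (t + s) y) \<partial>q_tilde S q x (t + s))"
      by (intro nn_integral_cmult measurable_compose[OF Vm[OF t(1)] measurable_ennreal])
    finally have d: "?d t = ennreal (exp (- \<alpha> * t) * ?E) * (\<integral>\<^sup>+y. ennreal (V (t + s) y) \<partial>q_tilde S q x (t + s))" .
    have "(\<integral>\<^sup>+y. ?W (ennreal (s + t), Some y) \<partial>q_tilde S q x (t + s)) =
       (\<integral>\<^sup>+y. ennreal (exp (- \<alpha> * (s + t))) * ennreal (V (t + s) y) \<partial>q_tilde S q x (t + s))"
      using True s
      by (intro nn_integral_cong) (simp add: potential_alive ennreal_mult'[symmetric] add.commute del: ennreal_plus)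
    also have "\<dots> = ennreal (exp (- \<alpha> * (s + t))) * (\<integral>\<^sup>+y. ennreal (V (t + s) y) \<partial>q_tilde S q x (t + s))"
      by (intro nn_integral_cmult measurable_compose[OF Vm[OF t(1)] measurable_ennreal])
    finally have w: "(\<integral>\<^sup>+y. ?W (ennreal (s + t), Some y) \<partial>q_tilde S q x (t + s)) = \<dots>" .
    have e: "ennreal (exp (\<alpha> * s)) * (ennreal ?E * ennreal (exp (- \<alpha> * (s + t)))) =
        ennreal (exp (- \<alpha> * t) * ?E)"
      by (simp add: ennreal_mult'[symmetric] exp_add[symmetric] algebra_simps)
    have "ennreal (exp (\<alpha> * s)) * ?I (s + 1 * t) = ennreal (exp (\<alpha> * s)) *
        (ennreal ?E * (ennreal (exp (- \<alpha> * (s + t))) *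
          (\<integral>\<^sup>+y. ennreal (V (t + s) y) \<partial>q_tilde S q x (t + s))))"
      using True by (simp only: mult_1 t(2) w survival_shift[OF s(1)]) simp
    also have "\<dots> = ?d t"
      unfolding d e[symmetric] by (simp only: mult.assoc)
    finally show ?thesis using True by simp
  next
    case False
    \<comment> \<open>Before \<open>s\<close> both sides are zero by their time restrictions; past
      \<open>T\<close> the right-hand side is zero because the potential is cut off.\<close>
    then consider "t < 0" | "0 < t" "T < s + t" using \<open>t \<noteq> 0\<close> by linarith
    then show ?thesis
    proof cases
      case 2
      then show ?thesis using s by (simp add: potential_late del: ennreal_plus)
    qed simp
  qed
  have Im': "(\<lambda>t. ?I (s + 1 * t)) \<in> borel_measurable lborel"
    by (rule measurable_compose[OF _ Im]) simp
  have "ennreal (exp (\<alpha> * s)) * JI s x ?W = ennreal (exp (\<alpha> * s)) * (\<integral>\<^sup>+t. ?I (s + 1 * t) \<partial>lborel)"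
    unfolding JI_R[OF s(1)] by (subst nn_integral_real_affine[OF Im, of 1 s]) simp_all
  also have "\<dots> = (\<integral>\<^sup>+t. ennreal (exp (\<alpha> * s)) * ?I (s + 1 * t) \<partial>lborel)"
    by (rule nn_integral_cmult[OF Im', symmetric])
  also have "\<dots> = (\<integral>\<^sup>+t\<in>{0..T - s}. ?d t \<partial>lborel)"
    by (rule nn_integral_cong_AE, use AE_lborel_singleton[of 0] in eventually_elim) (rule eq[symmetric])
  also have "\<dots> \<le> ennreal (V s x)" by (rule drift)
  finally have le: "ennreal (exp (\<alpha> * s)) * JI s x ?W \<le> ennreal (V s x)" .
  have "JI s x ?W = ennreal (exp (- \<alpha> * s)) * (ennreal (exp (\<alpha> * s)) * JI s x ?W)"
    by (simp add: mult.assoc[symmetric] ennreal_mult'[symmetric] exp_add[symmetric])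
  also have "\<dots> \<le> ennreal (exp (- \<alpha> * s)) * ennreal (V s x)"
    by (intro mult_left_mono le) simp
  also have "\<dots> = ?W (ennreal s, Some x)"
    using s by (simp add: potential_alive ennreal_mult')
  finally show ?thesis .
qed

section \<open>One step of the jump kernel on the barriers\<close>

lemma barrier_measurable:
  assumes "x0 \<in> S" "(\<lambda>(v, x). V v x) \<in> borel_measurable (borel_on {0..} \<Otimes>\<^sub>M borel_on S)"
  shows "barrier V \<alpha> T \<theta> \<epsilon> k \<in> borel_measurable (jump_space S)"
proof -
  note potential_measurable[OF assms, measurable]
  show ?thesis unfolding barrier_def[abs_def] by measurable
qed

text \<open>Two bounds on the left-hand side suffice: \<open>L1\<close>, since the kernel has mass
  one, and \<open>L2\<close>, obtained by dropping the cap. The set \<open>C\<close> separates the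
  states where jumps contract from those where the potential is large.\<close>

lemma nn_integral_jump_kernel_barrier_le:
  assumes x0: "x0 \<in> S"
    and V: "(\<lambda>(v, x). V v x) \<in> borel_measurable (borel_on {0..} \<Otimes>\<^sub>M borel_on S)"
    and T: "0 \<le> T" and \<theta>: "0 \<le> \<theta>"
    and excessive: "\<And>s x. 0 \<le> s \<Longrightarrow> s \<le> T \<Longrightarrow> x \<in> S \<Longrightarrow>
        JI s x (potential V \<alpha> T) \<le> potential V \<alpha> T (ennreal s, Some x)"
    and contraction: "\<And>s x. 0 \<le> s \<Longrightarrow> s \<le> T \<Longrightarrow> x \<in> C \<Longrightarrow> x \<in> S \<Longrightarrow> JI s x (before T) \<le> ennreal \<theta>"
    and large: "\<And>s x. 0 \<le> s \<Longrightarrow> s \<le> T \<Longrightarrow> x \<in> S \<Longrightarrow> x \<notin> C \<Longrightarrow>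
        1 \<le> ennreal \<epsilon> * potential V \<alpha> T (ennreal s, Some x)"
    and p: "p \<in> space (jump_space S)"
  shows "(\<integral>\<^sup>+p'. barrier V \<alpha> T \<theta> \<epsilon> k p' \<partial>jump_kernel S q p) \<le> barrier V \<alpha> T \<theta> \<epsilon> (Suc k) p"
    (is "?L \<le> _")
proof -
  let ?W = "potential V \<alpha> T" and ?B = "barrier V \<alpha> T \<theta> \<epsilon> k"
  \<comment> \<open>These values settle the absorbed case and cancel the \<open>defect\<close> term,
    the mass the kernel puts on never jumping again.\<close>
  have inf: "before T (\<infinity>, None) = 0" "?W (\<infinity>, None) = 0" "?B (\<infinity>, None) = 0"
    by (simp_all add: before_def potential_def barrier_def top_unique)
  show ?thesis
    using p
  proof (cases rule: jump_space_cases)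
    case absorbed
    have "?L = 0"
      unfolding absorbed(1) nn_integral_return[OF None_in_space barrier_measurable[OF x0 V]] by (rule inf)
    then show ?thesis by simp
  next
    case (alive s x)
    note barrier_measurable[OF alive(3) V, measurable] potential_measurable[OF alive(3) V, measurable]
    interpret K: prob_space "jump_kernel S q p" by (rule prob_space_jump_kernel[OF p])
    have "?L \<le> (\<integral>\<^sup>+p'. 1 \<partial>jump_kernel S q p)"
      by (intro nn_integral_mono) (simp add: barrier_def)
    then have L1: "?L \<le> 1" using K.emeasure_space_1 by simp
    have "?L \<le> (\<integral>\<^sup>+p'. ennreal (\<theta> ^ k) * before T p' + ennreal \<epsilon> * ?W p' \<partial>jump_kernel S q p)"
      by (intro nn_integral_mono) (simp add: barrier_def)
    also have "\<dots> = ennreal (\<theta> ^ k) * (\<integral>\<^sup>+p'. before T p' \<partial>jump_kernel S q p) +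
        ennreal \<epsilon> * (\<integral>\<^sup>+p'. ?W p' \<partial>jump_kernel S q p)"
      by (simp add: nn_integral_add nn_integral_cmult)
    also have "\<dots> = ennreal (\<theta> ^ k) * JI s x (before T) + ennreal \<epsilon> * JI s x ?W"
      unfolding alive(1) by (simp add: nn_integral_jump_kernel[OF alive(3,2)] inf[unfolded infinity_ennreal_def])
    finally have L2: "?L \<le> ennreal (\<theta> ^ k) * JI s x (before T) + ennreal \<epsilon> * JI s x ?W" .
    show ?thesis
    proof (cases "s \<le> T")
      case False
      have "JI s x (before T) = 0" "JI s x ?W = 0"
        by (rule JI_late[OF T]; use False T in \<open>simp add: before_alive potential_late\<close>)+
      then show ?thesis using L2 by simp
    next
      case True
      show ?thesis
      proof (cases "x \<in> C")
        case False
        \<comment> \<open>Off \<open>C\<close> the potential term alone reaches the cap, so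
          \<open>L1\<close> is enough.\<close>
        then have "1 \<le> ennreal (\<theta> ^ Suc k) * before T p + ennreal \<epsilon> * ?W p"
          using large[OF alive(2) True alive(3)] unfolding alive(1) by (simp add: add_increasing)
        then show ?thesis using L1 by (simp add: barrier_def)
      next
        case C: True
        \<comment> \<open>On \<open>C\<close> a jump by time \<open>T\<close> costs a factor
          \<open>\<theta>\<close>, which raises the exponent from \<open>k\<close> to
          \<open>Suc k\<close>.\<close>
        have "ennreal (\<theta> ^ k) * JI s x (before T) \<le> ennreal (\<theta> ^ k) * ennreal \<theta>"
          by (intro mult_left_mono contraction alive True C) simp
        also have "\<dots> = ennreal (\<theta> ^ Suc k) * before T p"
          using \<theta> T True by (simp add: alive(1) before_alive ennreal_mult'[symmetric] mult.commute)
        finally have "?L \<le> ennreal (\<theta> ^ Suc k) * before T p + ennreal \<epsilon> * ?W p"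
          using excessive[OF alive(2) True alive(3)] unfolding alive(1)
          by (intro order_trans[OF L2[unfolded alive(1)]] add_mono mult_left_mono) auto
        then show ?thesis using L1 by (simp add: barrier_def)
      qed
    qed
  qed
qed

section \<open>Iteration along the chain and passage beyond \<open>T\<close>\<close>

text \<open>By the Markov property, conditioning on \<open>\<omega> n\<close> trades one step of the
  chain for one increment of the index; hence \<open>k\<close> is arbitrary in the
  induction.\<close>

lemma jump_law_iterate_le:
  assumes x: "x \<in> S"
    and B: "\<And>k. B k \<in> borel_measurable (jump_space S)"
    and step: "\<And>k p. p \<in> space (jump_space S) \<Longrightarrow> (\<integral>\<^sup>+p'. B k p' \<partial>jump_kernel S q p) \<le> B (Suc k) p"
  shows "(\<integral>\<^sup>+\<omega>. B k (\<omega> n) \<partial>jump_law S q x) \<le> B (k + n) (0, Some x)"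
proof (induction n arbitrary: k)
  case 0
  interpret JL: prob_space "jump_law S q x" by (rule prob_space_jump_law[OF x])
  have "(\<integral>\<^sup>+\<omega>. B k (\<omega> 0) \<partial>jump_law S q x) = (\<integral>\<^sup>+\<omega>. B k (0, Some x) \<partial>jump_law S q x)"
    by (rule nn_integral_cong_AE, use jump_law_0[OF x] in eventually_elim) simp
  then show ?case using JL.emeasure_space_1 by simp
next
  case (Suc n)
  note B[measurable]
  have "(\<integral>\<^sup>+\<omega>. B k (\<omega> (Suc n)) \<partial>jump_law S q x) =
      (\<integral>\<^sup>+\<omega>. (\<integral>\<^sup>+p. B k p \<partial>jump_kernel S q (\<omega> n)) \<partial>jump_law S q x)"
    by (rule jump_law_pair[OF x, of "\<lambda>_. B k"]) measurable
  also have "\<dots> \<le> (\<integral>\<^sup>+\<omega>. B (Suc k) (\<omega> n) \<partial>jump_law S q x)"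
    by (intro nn_integral_mono step) (auto simp: space_jump_law[OF x] space_PiM PiE_iff)
  also have "\<dots> \<le> B (Suc k + n) (0, Some x)" by (rule Suc)
  finally show ?case by simp
qed

lemma jump_times_exceed:
  assumes x: "x \<in> S" and T: "0 < T" and \<alpha>: "0 < \<alpha>"
    and V: "(\<lambda>(v, x). V v x) \<in> borel_measurable (borel_on {0..} \<Otimes>\<^sub>M borel_on S)"
    and large: "\<And>c. \<exists>n. \<forall>v\<in>{0..T}. \<forall>y\<in>S - Sn n. c \<le> V v y"
    and bounded: "\<And>n. \<exists>K. \<forall>v\<in>{0..T}. \<forall>y\<in>Sn n. q_rate q y v \<le> K"
    and drift: "\<And>v y. v \<in> {0..T} \<Longrightarrow> y \<in> S \<Longrightarrow>
      (\<integral>\<^sup>+t\<in>{0..T - v}. (\<integral>\<^sup>+z. ennreal (V (t + v) z *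
          exp (- \<alpha> * t - (LBINT s:{0..t}. q_rate q y (s + v)))) \<partial>q_tilde S q y (t + v)) \<partial>lborel)
        \<le> ennreal (V v y)"
  shows "AE \<omega> in jump_law S q x. \<exists>n. ennreal T < fst (\<omega> n)"
proof -
  let ?J = "jump_law S q x"
  let ?A = "{\<omega> \<in> space ?J. \<forall>n. fst (\<omega> n) \<le> ennreal T}"
  have A: "?A \<in> sets ?J"
  proof -
    have "Measurable.pred ?J (\<lambda>\<omega>. \<forall>n. fst (\<omega> n) \<le> ennreal T)"
      unfolding measurable_cong_sets[OF sets_jump_law[OF x] refl] by measurable
    then show ?thesis by (simp add: pred_def)
  qed
  have le: "emeasure ?J ?A \<le> ennreal (\<epsilon> * V 0 x)" if \<epsilon>: "0 < \<epsilon>" for \<epsilon>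
  proof -
    \<comment> \<open>The level \<open>exp (\<alpha> * T) / \<epsilon>\<close> offsets both the
      factor \<open>\<epsilon>\<close> and the strongest discount on \<open>{0..T}\<close>, the one
      at time \<open>T\<close>.\<close>
    obtain m where m: "\<And>v y. v \<in> {0..T} \<Longrightarrow> y \<in> S \<Longrightarrow> y \<notin> Sn m \<Longrightarrow> exp (\<alpha> * T) / \<epsilon> \<le> V v y"
      using large by blast
    obtain K' where K': "\<And>v y. v \<in> {0..T} \<Longrightarrow> y \<in> Sn m \<Longrightarrow> q_rate q y v \<le> K'"
      using bounded by blast
    \<comment> \<open>\<open>K'\<close> may be negative when \<open>Sn m\<close> is empty; the
      maximum with zero ensures \<open>0 \<le> \<theta>\<close>.\<close>
    define K where "K = max 0 K'"
    have K: "0 \<le> K" "\<And>v y. v \<in> {0..T} \<Longrightarrow> y \<in> Sn m \<Longrightarrow> q_rate q y v \<le> K"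
      using K' by (auto simp: K_def intro: max.coboundedI2)
    define \<theta> where "\<theta> = 1 - exp (- K * T)"
    have \<theta>: "0 \<le> \<theta>" "\<theta> < 1" using K(1) T by (auto simp: \<theta>_def)
    let ?B = "barrier V \<alpha> T \<theta> \<epsilon>"
    have step: "(\<integral>\<^sup>+p'. ?B k p' \<partial>jump_kernel S q p) \<le> ?B (Suc k) p" if "p \<in> space (jump_space S)" for k p
    proof (rule nn_integral_jump_kernel_barrier_le[OF x V _ \<theta>(1) _ _ _ that, where C="Sn m"])
      fix s y assume s: "0 \<le> s" "s \<le> T" and y: "y \<in> S"
      show "JI s y (potential V \<alpha> T) \<le> potential V \<alpha> T (ennreal s, Some y)"
        by (rule JI_potential_le[OF y s V]) (rule drift, use s y in auto)
      show "JI s y (before T) \<le> ennreal \<theta>" if "y \<in> Sn m"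
        unfolding JI_before[OF y s] \<theta>_def
        using survival_ge[OF y s K(1) K(2)[OF _ that]] by (intro ennreal_leI) simp
      show "1 \<le> ennreal \<epsilon> * potential V \<alpha> T (ennreal s, Some y)" if "y \<notin> Sn m"
      proof -
        have "1 \<le> \<epsilon> * (exp (- \<alpha> * s) * (exp (\<alpha> * T) / \<epsilon>))"
          using \<epsilon> \<alpha> s by (simp add: exp_add[symmetric])
        also have "\<dots> \<le> \<epsilon> * (exp (- \<alpha> * s) * V s y)"
          using m[of s y] s y that \<epsilon> by (intro mult_left_mono) auto
        finally have "ennreal 1 \<le> ennreal (\<epsilon> * (exp (- \<alpha> * s) * V s y))" by (rule ennreal_leI)
        then show ?thesis using s \<epsilon> by (simp add: potential_alive ennreal_mult')
      qed
    qed (use T in auto)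
    have "emeasure ?J ?A \<le> ennreal (\<theta> ^ n) + ennreal (\<epsilon> * V 0 x)" for n
    proof -
      have "emeasure ?J ?A = (\<integral>\<^sup>+\<omega>. indicator ?A \<omega> \<partial>?J)" using A by simp
      \<comment> \<open>On \<open>?A\<close> the \<open>n\<close>-th jump is no later than
        \<open>T\<close>, and \<open>\<theta> ^ 0 = 1\<close>, so \<open>?B 0\<close> equals one
        there.\<close>
      also have "\<dots> \<le> (\<integral>\<^sup>+\<omega>. ?B 0 (\<omega> n) \<partial>?J)"
        by (intro nn_integral_mono) (auto simp: barrier_def before_def add_increasing2 split: split_indicator)
      also have "\<dots> \<le> ?B (0 + n) (0, Some x)"
        by (rule jump_law_iterate_le[where B="?B", OF x barrier_measurable[OF x V] step])
      also have "\<dots> \<le> ennreal (\<theta> ^ n) + ennreal (\<epsilon> * V 0 x)"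
        using T \<epsilon> by (simp add: barrier_def before_def potential_def ennreal_mult')
      finally show ?thesis .
    qed
    moreover have "(\<lambda>n. ennreal (\<theta> ^ n) + ennreal (\<epsilon> * V 0 x)) \<longlonglongrightarrow> ennreal 0 + ennreal (\<epsilon> * V 0 x)"
      using \<theta> by (intro tendsto_add tendsto_ennrealI LIMSEQ_realpow_zero tendsto_const) auto
    ultimately show ?thesis by (intro LIMSEQ_le_const) auto
  qed
  \<comment> \<open>As \<open>V 0 x\<close> is a finite real, the bound tends to zero when
    \<open>\<epsilon>\<close> decreases to zero.\<close>
  have "((\<lambda>\<epsilon>. ennreal (\<epsilon> * V 0 x)) \<longlongrightarrow> ennreal (0 * V 0 x)) (at_right 0)"
    by (intro tendsto_ennrealI tendsto_intros)
  then have "emeasure ?J ?A \<le> ennreal (0 * V 0 x)"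
    by (rule tendsto_lowerbound) (auto simp: eventually_at_right_less intro!: eventually_mono[OF eventually_at_right_less] le)
  then have "emeasure ?J ?A = 0" by simp
  with A have "?A \<in> null_sets ?J" by (simp add: null_sets_def)
  then show ?thesis by (rule AE_I') (auto simp: not_less)
qed

end

section \<open>Nonexplosion from the drift condition\<close>

theorem corollary3p2:
  fixes S :: "'a::polish_space set"
    and q :: "'a set \<Rightarrow> 'a \<Rightarrow> real \<Rightarrow> real"
    and Sn :: "nat \<Rightarrow> 'a set"
    and V :: "real \<Rightarrow> 'a \<Rightarrow> real"
  assumes S: "S \<in> sets borel" "S \<noteq> {}"
    and q: "q_function S q"
    and Sn: "range Sn \<subseteq> sets (borel_on S)" "incseq Sn"
    and V_measurable: "(\<lambda>(v, x). V v x) \<in> borel_measurable (borel_on {0..} \<Otimes>\<^sub>M borel_on S)"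
    and V_nonneg: "\<And>v x. v \<ge> 0 \<Longrightarrow> x \<in> S \<Longrightarrow> 0 \<le> V v x"
    and a: "(\<Union>n. Sn n) = S"
    and b: "\<And>T. T > 0 \<Longrightarrow>
      (\<lambda>n. INF (v, x)\<in>{0..T} \<times> (S - Sn n). ereal (V v x)) \<longlonglongrightarrow> \<infinity>"
    and c: "\<And>T n. T > 0 \<Longrightarrow> (SUP (v, x)\<in>{0..T} \<times> Sn n. ereal (q_rate q x v)) < \<infinity>"
    and d: "\<And>T. T > 0 \<Longrightarrow> \<exists>\<alpha>>0. \<forall>v\<in>{0..T}. \<forall>x\<in>S.
      (\<integral>\<^sup>+t\<in>{0..T - v}. (\<integral>\<^sup>+y. ennreal (V (t + v) y *
          exp (- \<alpha> * t - (LBINT s:{0..t}. q_rate q x (s + v)))) \<partial>q_tilde S q x (t + v)) \<partial>lborel)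
        \<le> ennreal (V v x)"
  shows "nonexplosive S q"
proof -
  interpret Q_function S q by unfold_locales (use S q in auto)
  show ?thesis
    unfolding nonexplosive_def
  proof
    fix x assume x: "x \<in> S"
    have exceed: "AE \<omega> in jump_law S q x. \<exists>n. ennreal T < fst (\<omega> n)" if T: "T > 0" for T
    proof -
      obtain \<alpha> where \<alpha>: "0 < \<alpha>" "\<And>v y. v \<in> {0..T} \<Longrightarrow> y \<in> S \<Longrightarrow>
          (\<integral>\<^sup>+t\<in>{0..T - v}. (\<integral>\<^sup>+z. ennreal (V (t + v) z *
              exp (- \<alpha> * t - (LBINT s:{0..t}. q_rate q y (s + v)))) \<partial>q_tilde S q y (t + v)) \<partial>lborel)
            \<le> ennreal (V v y)"
        using d[OF T] by blast
      have large: "\<exists>n. \<forall>v\<in>{0..T}. \<forall>y\<in>S - Sn n. c \<le> V v y" for c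
      proof -
        \<comment> \<open>Of the divergence only a single index with infimum above \<open>c\<close>
          is kept; if \<open>Sn n\<close> is all of \<open>S\<close>, the infimum is infinite and
          the bound is vacuous.\<close>
        have "\<forall>\<^sub>F n in sequentially. ereal c < (INF (v, x)\<in>{0..T} \<times> (S - Sn n). ereal (V v x))"
          by (rule order_tendstoD(1)[OF b[OF T]]) simp
        then obtain n where n: "ereal c < (INF (v, x)\<in>{0..T} \<times> (S - Sn n). ereal (V v x))"
          by (auto simp: eventually_sequentially)
        have "c \<le> V v y" if "v \<in> {0..T}" "y \<in> S - Sn n" for v y
          using less_le_trans[OF n INF_lower[of "(v, y)"]] that by simp
        then show ?thesis by blast
      qed
      have bounded: "\<exists>K. \<forall>v\<in>{0..T}. \<forall>y\<in>Sn n. q_rate q y v \<le> K" for n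
      proof -
        obtain k :: nat where k: "(SUP (v, x)\<in>{0..T} \<times> Sn n. ereal (q_rate q x v)) < ereal (real k)"
          using c[OF T, of n] less_PInf_Ex_of_nat by auto
        have "q_rate q y v \<le> real k" if "v \<in> {0..T}" "y \<in> Sn n" for v y
          using le_less_trans[OF SUP_upper[of "(v, y)"] k] that by simp
        then show ?thesis by blast
      qed
      show ?thesis by (rule jump_times_exceed[OF x T \<alpha>(1) V_measurable large bounded \<alpha>(2)])
    qed
    \<comment> \<open>Countably many horizons suffice; \<open>Suc m\<close> keeps each of them
      positive, as \<open>exceed\<close> requires.\<close>
    have "AE \<omega> in jump_law S q x. \<forall>m. \<exists>n. ennreal (real (Suc m)) < fst (\<omega> n)"
      by (subst AE_all_countable) (intro allI exceed, simp)
    then show "AE \<omega> in jump_law S q x. explosion_time \<omega> = \<infinity>"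
      using jump_times_incseq[OF x]
      by eventually_elim (simp add: explosion_time_def incseq_lim_eq_infinity)
  qed
qed

end
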